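(* Let $0<H<1$ and $0<K<1$ be such that $2HK>1$. For $x,y>0$ with $x\ne y$ let $$g(x,y)=2^{2-K}H^2K(K-1)(x^{2H}+y^{2H})^{K-2}(xy)^{2H-1}+2^{1-K}HK(2HK-1)|x-y|^{2HK-2}.$$ Let $(\xi_j,\ j=1,2,\dots)$ be a jointly Gaussian sequence of standard normal random variables such that $E[\xi_i\xi_j]=g(i,j)$ for all $i\ne j$. Then, as $n\to\infty$, the processes $$\left(n^{-HK}\sum_{j=1}^{[nt]}\xi_j,\ t\ge0\right)$$ converge, in the sense of all finite dimensional distributions, to a bifractional Brownian motion $\left(B^{H,K}_t,\ t\ge 0\right)$ with parameters $H,K$.
   Context: For $H\in(0,1)$, $K\in(0,1]$, the bifractional Brownian motion $B^{H,K}=(B^{H,K}_t,\ t\ge0)$ is the centered Gaussian process with covariance $E[B^{H,K}_tB^{H,K}_s]=2^{-K}\left((t^{2H}+s^{2H})^K-|t-s|^{2HK}\right)$. $[x]$ denotes the integer part of $x$; empty sums are $0$. *)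

theory Defs
  imports "HOL-Probability.Probability"
begin

text \<open>Normal random variables; the degenerate case of variance zero is included.\<close>

definition normal_rv :: "'a measure \<Rightarrow> ('a \<Rightarrow> real) \<Rightarrow> bool" where
  "normal_rv M X \<longleftrightarrow> X \<in> borel_measurable M \<and>
     (\<exists>\<mu>. (AE \<omega> in M. X \<omega> = \<mu>) \<or>
          (\<exists>\<sigma>>0. distributed M lborel X (normal_density \<mu> \<sigma>)))"

text \<open>A family of random variables is jointly Gaussian if every finite linear combination
  is normal.\<close>

definition jointly_gaussian :: "'a measure \<Rightarrow> 'i set \<Rightarrow> ('i \<Rightarrow> 'a \<Rightarrow> real) \<Rightarrow> bool" where
  "jointly_gaussian M I X \<longleftrightarrow> prob_space M \<and>
     (\<forall>J c. finite J \<and> J \<subseteq> I \<longrightarrow> normal_rv M (\<lambda>\<omega>. \<Sum>i\<in>J. c i * X i \<omega>))"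

text \<open>The time parameter is a real number; only the values at times \<open>t \<ge> 0\<close> matter.\<close>

definition bifractional_brownian_motion ::
    "real \<Rightarrow> real \<Rightarrow> 'a measure \<Rightarrow> (real \<Rightarrow> 'a \<Rightarrow> real) \<Rightarrow> bool" where
  "bifractional_brownian_motion H K M B \<longleftrightarrow>
     H \<in> {0<..<1} \<and> K \<in> {0<..1} \<and>
     jointly_gaussian M {0..} B \<and>
     (\<forall>t\<ge>0. (\<integral>\<omega>. B t \<omega> \<partial>M) = 0) \<and>
     (\<forall>t\<ge>0. \<forall>s\<ge>0. (\<integral>\<omega>. B t \<omega> * B s \<omega> \<partial>M) =
        2 powr (-K) * ((t powr (2*H) + s powr (2*H)) powr K - \<bar>t - s\<bar> powr (2*H*K)))"

definition bfbm_g :: "real \<Rightarrow> real \<Rightarrow> real \<Rightarrow> real \<Rightarrow> real" where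
  "bfbm_g H K x y =
     2 powr (2 - K) * H\<^sup>2 * K * (K - 1)
       * (x powr (2*H) + y powr (2*H)) powr (K - 2) * (x * y) powr (2*H - 1)
     + 2 powr (1 - K) * H * K * (2*H*K - 1) * \<bar>x - y\<bar> powr (2*H*K - 2)"

definition weakly_converges :: "'b topology \<Rightarrow> (nat \<Rightarrow> 'b measure) \<Rightarrow> 'b measure \<Rightarrow> bool" where
  "weakly_converges T \<mu>s \<mu> \<longleftrightarrow>
     (\<forall>f. continuous_map T euclideanreal f \<and> bounded (f ` topspace T) \<longrightarrow>
        (\<lambda>n. \<integral>x. f x \<partial>(\<mu>s n)) \<longlonglongrightarrow> (\<integral>x. f x \<partial>\<mu>))"

text \<open>The joint law of the values of a process at the times in \<open>J\<close>, on the space of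
  real functions on \<open>J\<close>.\<close>

definition fd_law :: "'a measure \<Rightarrow> ('t \<Rightarrow> 'a \<Rightarrow> real) \<Rightarrow> 't set \<Rightarrow> ('t \<Rightarrow> real) measure" where
  "fd_law M X J = distr M (\<Pi>\<^sub>M t\<in>J. borel) (\<lambda>\<omega>. \<lambda>t\<in>J. X t \<omega>)"

definition fdd_converges ::
    "'t set \<Rightarrow> 'a measure \<Rightarrow> (nat \<Rightarrow> 't \<Rightarrow> 'a \<Rightarrow> real) \<Rightarrow> 'b measure \<Rightarrow> ('t \<Rightarrow> 'b \<Rightarrow> real) \<Rightarrow> bool" where
  "fdd_converges I M X N Y \<longleftrightarrow>
     (\<forall>J. finite J \<and> J \<subseteq> I \<longrightarrow>
        weakly_converges (product_topology (\<lambda>_. euclideanreal) J)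
          (\<lambda>n. fd_law M (X n) J) (fd_law N Y J))"

end

theory Submission
  imports Defs "HOL-Real_Asymp.Real_Asymp"
begin

text \<open>Write \<open>p = 2 * H\<close>, \<open>a = 2 * H * K\<close> and \<open>R\<close> for the limit covariance. Up to the factor
  \<open>2 powr (-K)\<close>, the function \<open>bfbm_g\<close> is the mixed second derivative of
  \<open>(x powr p + y powr p) powr K - \<bar>x - y\<bar> powr a\<close>. Replacing it on each unit cell by the corresponding
  mixed second difference gives telescoping double sums, and by homogeneity the rescaled covariances
  converge to \<open>R\<close>; the replacement errors and the diagonal terms are \<open>O(n)\<close>, or relatively small, and
  \<open>a > 1\<close>. In particular \<open>R\<close> is positive semidefinite. A pivoted Cholesky decomposition of \<open>R\<close> along
  a dense sequence of times then realises a Gaussian process with covariance \<open>R\<close> on a space of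
  independent standard normal variables. Finally, characteristic functions of centered Gaussian
  vectors depend continuously on the covariance, and bounded continuous functions are approximated
  by trigonometric polynomials, with Chebyshev's inequality controlling the error outside a large
  cube.\<close>

subsection \<open>Convergence of the covariances\<close>

text \<open>The sign in \<open>cell\<close> is chosen so that both kernels give positive values:
  their mixed second derivatives are negative off the diagonal. The two summands of the covariance
  call for different comparisons. For |x - y|^a the error at (i, j) depends on |i - j| alone and is
  summable in it, so every row costs at most a constant. For (x^p + y^p)^K the density varies with
  both coordinates; its value at a grid point is trapped between multiples of the two cells that
  have this point as upper and as lower corner. These multiples tend to 1 away from the axes, and
  the strips along the axes are of smaller order than n^a. No analytic proof that the limit
  covariance is positive semidefinite is attempted: the property is inherited from the covariances
  of the partial sums, so the limit process can only be built after the covariance limit is known.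
  The same limit also bounds the second moments uniformly in n, which supplies the tightness, and
  fixes the limits of all cosine expectations.\<close>

definition cell :: "(real \<Rightarrow> real \<Rightarrow> real) \<Rightarrow> nat \<Rightarrow> nat \<Rightarrow> real" where
  "cell G i j = G (real i) (real (Suc j)) + G (real (Suc i)) (real j)
     - G (real i) (real j) - G (real (Suc i)) (real (Suc j))"

text \<open>Both sums telescope. The shift \<open>d\<close> serves the two sides of the later
  sandwich: \<open>d = 0\<close> bounds the density sum from above, \<open>d = 1\<close> from
  below.\<close>

lemma sum_cell:
  "(\<Sum>i<P. \<Sum>j<Q. cell G (i + d) (j + d)) =
     G (real d) (real (Q + d)) + G (real (P + d)) (real d) - G (real d) (real d) - G (real (P + d)) (real (Q + d))"
proof -
  have "(\<Sum>j<Q. cell G (i + d) (j + d)) =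
      (G (real (i + d)) (real (Q + d)) - G (real (Suc i + d)) (real (Q + d)))
      - (G (real (i + d)) (real d) - G (real (Suc i + d)) (real d))" for i
    by (induction Q) (simp_all add: cell_def)
  then show ?thesis
    by (induction P) simp_all
qed

lemma sum_cell_0:
  "(\<Sum>i<P. \<Sum>j<Q. cell G i j) = G 0 (real Q) + G (real P) 0 - G 0 0 - G (real P) (real Q)"
  using sum_cell[where d=0 and G=G and P=P and Q=Q] by simp

text \<open>The mean value theorem, once in each variable. In the coordinates
  \<open>u = x powr p\<close>, \<open>v = y powr p\<close> the kernel depends on
  \<open>u + v\<close> only, so a single intermediate value \<open>z\<close> of the sum appears, in
  a monotone factor.\<close>

lemma powr_mixed_difference:
  fixes K :: real
  assumes K: "0 < K" "K < 1" and u: "0 \<le> u" "u < u'" and v: "0 \<le> v" "v < v'"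
  obtains z where "u + v < z" "z < u' + v'"
    "(u + v') powr K + (u' + v) powr K - (u + v) powr K - (u' + v') powr K =
       K * (1 - K) * z powr (K - 2) * (u' - u) * (v' - v)"
proof -
  define f where "f x = (x + v) powr K - (x + v') powr K" for x
  have "continuous_on {u..u'} f"
    unfolding f_def using u v K by (intro continuous_intros continuous_on_powr') auto
  \<comment> \<open>At \<open>u = v = 0\<close> the derivative is singular, so the first application
    uses differentiability only inside the interval and continuity at its ends; afterwards
    \<open>x > 0\<close> removes the problem.\<close>
  moreover have fd: "(f has_real_derivative K * ((x + v) powr (K - 1) - (x + v') powr (K - 1))) (at x)"
    if "u < x" for x
    unfolding f_def using u v that
    by (auto intro!: derivative_eq_intros simp: algebra_simps)
  ultimately obtain x where x: "u < x" "x < u'"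
    "f u' - f u = (u' - u) * (K * ((x + v) powr (K - 1) - (x + v') powr (K - 1)))"
    using MVT[of u u' f] u(2) by (metis DERIV_unique real_differentiable_def)
  have "((\<lambda>y. (x + y) powr (K - 1)) has_real_derivative (K - 1) * (x + y) powr (K - 2)) (at y)"
    if "v \<le> y" for y
    using u v x that by (auto intro!: derivative_eq_intros)
  from MVT2[of v v', OF v(2) this] obtain y where y: "v < y" "y < v'"
    "(x + v') powr (K - 1) - (x + v) powr (K - 1) = (v' - v) * ((K - 1) * (x + y) powr (K - 2))"
    by blast
  have "f u' - f u = (u' - u) * (K * (- ((v' - v) * ((K - 1) * (x + y) powr (K - 2)))))"
    unfolding x(3) y(3)[symmetric] by simp
  then have "(u + v') powr K + (u' + v) powr K - (u + v) powr K - (u' + v') powr K =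
       K * (1 - K) * (x + y) powr (K - 2) * (u' - u) * (v' - v)"
    by (simp add: f_def algebra_simps)
  with x y show ?thesis by (intro that[of "x + y"]) auto
qed

text \<open>A sandwich whose bounds depend on \<open>e\<close> and miss the limit by the relative
  error \<open>e\<close>; such bounds arise when finitely many rows and columns are cut off
  depending on \<open>e\<close>.\<close>

lemma tendsto_of_eps_bounds:
  fixes S :: "nat \<Rightarrow> real"
  assumes "\<And>e. 0 < e \<Longrightarrow> e < 1 \<Longrightarrow> \<exists>A B. A \<longlonglongrightarrow> (1 - e) * l \<and> B \<longlonglongrightarrow> (1 + e) * l \<and>
      (\<forall>\<^sub>F n in sequentially. A n \<le> S n \<and> S n \<le> B n)"
  shows "S \<longlonglongrightarrow> l"
proof (rule LIMSEQ_I)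
  fix r :: real assume r: "0 < r"
  \<comment> \<open>What matters is \<open>e * \<bar>l\<bar> < r\<close>; the summand 1 covers
    \<open>l = 0\<close>.\<close>
  define e where "e = min (1/2) (r / (2 * (\<bar>l\<bar> + 1)))"
  have e: "0 < e" "e < 1" using r by (auto simp: e_def)
  have "e * \<bar>l\<bar> \<le> r / (2 * (\<bar>l\<bar> + 1)) * \<bar>l\<bar>"
    by (rule mult_right_mono) (auto simp: e_def)
  also have "\<dots> = r / 2 * (\<bar>l\<bar> / (\<bar>l\<bar> + 1))" by simp
  also have "\<dots> < r"
    using r by (simp add: field_simps) (smt (verit) mult_nonneg_nonneg)
  finally have el: "\<bar>e * l\<bar> < r" using e by (simp add: abs_mult)
  from assms[OF e] obtain A B where A: "A \<longlonglongrightarrow> (1 - e) * l" and B: "B \<longlonglongrightarrow> (1 + e) * l"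
    and AB: "\<forall>\<^sub>F n in sequentially. A n \<le> S n \<and> S n \<le> B n" by blast
  have "l - r < (1 - e) * l" "(1 + e) * l < l + r"
    using el by (auto simp: algebra_simps abs_less_iff)
  then have "\<forall>\<^sub>F n in sequentially. l - r < A n" "\<forall>\<^sub>F n in sequentially. B n < l + r"
    using order_tendstoD(1)[OF A] order_tendstoD(2)[OF B] by auto
  with AB have "\<forall>\<^sub>F n in sequentially. norm (S n - l) < r"
    by eventually_elim (auto simp: abs_less_iff)
  then show "\<exists>no. \<forall>n\<ge>no. norm (S n - l) < r"
    by (simp add: eventually_sequentially)
qed

lemma floor_mult_divide_tendsto:
  fixes t :: real
  assumes "0 \<le> t"
  shows "(\<lambda>n. real (nat \<lfloor>real n * t\<rfloor>) / real n) \<longlonglongrightarrow> t"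
proof (rule tendsto_sandwich)
  show "\<forall>\<^sub>F n in sequentially. t - 1 / real n \<le> real (nat \<lfloor>real n * t\<rfloor>) / real n"
    using eventually_gt_at_top[of 0]
  proof eventually_elim
    case (elim n)
    have "real n * t - 1 \<le> real (nat \<lfloor>real n * t\<rfloor>)" by linarith
    then have "(real n * t - 1) / real n \<le> real (nat \<lfloor>real n * t\<rfloor>) / real n"
      by (rule divide_right_mono) simp
    with elim show ?case by (simp add: diff_divide_distrib)
  qed
  show "\<forall>\<^sub>F n in sequentially. real (nat \<lfloor>real n * t\<rfloor>) / real n \<le> t"
    using eventually_gt_at_top[of 0]
  proof eventually_elim
    case (elim n)
    have "real (nat \<lfloor>real n * t\<rfloor>) \<le> real n * t" using assms by simp
    with elim show ?case by (simp add: field_simps)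
  qed
  show "(\<lambda>n. t - 1 / real n) \<longlonglongrightarrow> t" by real_asymp
qed simp

text \<open>On either side of \<open>i\<close> each distance occurs at most once, so each side
  contributes at most \<open>C\<close>.\<close>

lemma sum_abs_diff_le:
  fixes r :: "nat \<Rightarrow> real"
  assumes r: "\<And>m. 0 \<le> r m" and C: "\<And>N. (\<Sum>m<N. r m) \<le> C"
  shows "(\<Sum>j<Q. r (nat \<bar>int i - int j\<bar>)) \<le> 2 * C"
proof -
  define N where "N = Suc (i + Q)"
  have part: "(\<Sum>j\<in>A. r (nat \<bar>int i - int j\<bar>)) \<le> C"
    if A: "A \<subseteq> {..<Q}" "inj_on (\<lambda>j. nat \<bar>int i - int j\<bar>) A" for A
  proof -
    have "(\<Sum>j\<in>A. r (nat \<bar>int i - int j\<bar>)) = sum r ((\<lambda>j. nat \<bar>int i - int j\<bar>) ` A)"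
      by (simp add: sum.reindex[OF A(2)])
    also have "\<dots> \<le> (\<Sum>m<N. r m)"
      using A(1) by (intro sum_mono2) (auto simp: N_def r)
    also have "\<dots> \<le> C" by (rule C)
    finally show ?thesis .
  qed
  have "{..<Q} = {j. j < Q \<and> j \<le> i} \<union> {j. j < Q \<and> i < j}" by auto
  moreover have "{j. j < Q \<and> j \<le> i} \<inter> {j. j < Q \<and> i < j} = {}" by auto
  ultimately have "(\<Sum>j<Q. r (nat \<bar>int i - int j\<bar>)) =
      (\<Sum>j\<in>{j. j < Q \<and> j \<le> i}. r (nat \<bar>int i - int j\<bar>)) + (\<Sum>j\<in>{j. j < Q \<and> i < j}. r (nat \<bar>int i - int j\<bar>))"
    by (metis (no_types, lifting) finite_Un finite_lessThan sum.union_disjoint)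
  also have "\<dots> \<le> C + C"
    by (intro add_mono part) (auto simp: inj_on_def)
  finally show ?thesis by simp
qed

section \<open>The kernel (x^p + y^p)^K and its mixed derivative\<close>

context
  fixes p K :: real
begin

definition pow_kernel :: "real \<Rightarrow> real \<Rightarrow> real" where
  "pow_kernel x y = (x powr p + y powr p) powr K"

text \<open>Minus the mixed second partial derivative of \<open>pow_kernel\<close>, in agreement
  with the sign of \<open>cell\<close>.\<close>

definition pow_density :: "real \<Rightarrow> real \<Rightarrow> real" where
  "pow_density x y = K * (1 - K) * (x powr p + y powr p) powr (K - 2) * (p * x powr (p - 1)) * (p * y powr (p - 1))"

text \<open>One-dimensional correction factors: they replace the increment of
  \<open>x powr p\<close> over the unit interval below the point \<open>i + 1\<close> (for
  \<open>ratio_above\<close>, the interval above it) by the derivative at that point.\<close>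

definition ratio_below :: "nat \<Rightarrow> real" where
  "ratio_below i = p * real (Suc i) powr (p - 1) / (real (Suc i) powr p - real i powr p)"

definition ratio_above :: "nat \<Rightarrow> real" where
  "ratio_above i = p * real (Suc i) powr (p - 1) / (real (Suc (Suc i)) powr p - real (Suc i) powr p)"

context
  fixes a :: real
  assumes p: "1 < p" and K: "0 < K" "K < 1" and a_def: "a = p * K" and a: "1 < a"
begin

text \<open>Homogeneity of degree \<open>p * K\<close> moves the scaling factor into the arguments,
  where continuity applies.\<close>

lemma pow_kernel_scaled_tendsto:
  assumes x: "(\<lambda>n. x n / real n) \<longlonglongrightarrow> t" and y: "(\<lambda>n. y n / real n) \<longlonglongrightarrow> s"
    and pos: "\<And>n. 0 \<le> x n" "\<And>n. 0 \<le> y n"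
  shows "(\<lambda>n. real n powr (-a) * pow_kernel (x n) (y n)) \<longlonglongrightarrow> pow_kernel t s"
proof -
  have "(\<lambda>n. pow_kernel (x n / real n) (y n / real n)) \<longlonglongrightarrow> pow_kernel t s"
    unfolding pow_kernel_def using p K pos
    by (intro tendsto_powr' tendsto_add x y tendsto_const disjI2 conjI) auto
  moreover have "\<forall>\<^sub>F n in sequentially.
      pow_kernel (x n / real n) (y n / real n) = real n powr (-a) * pow_kernel (x n) (y n)"
    using eventually_gt_at_top[of 0]
  proof eventually_elim
    case (elim n)
    have "(x n / real n) powr p + (y n / real n) powr p = (x n powr p + y n powr p) * real n powr (-p)"
      using pos elim by (simp add: powr_divide powr_minus field_simps)
    then have "pow_kernel (x n / real n) (y n / real n) = pow_kernel (x n) (y n) * (real n powr (-p)) powr K"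
      unfolding pow_kernel_def by (simp add: powr_mult)
    then show ?case by (simp add: powr_powr a_def)
  qed
  ultimately show ?thesis by (rule Lim_transform_eventually)
qed

text \<open>The intermediate value \<open>z\<close> lies between the sums at the two extreme
  corners, and \<open>z powr (K - 2)\<close> is decreasing. The upper bound requires
  \<open>0 < i\<close> because \<open>0 powr (K - 2)\<close> is 0, which would make it false at the
  origin.\<close>

lemma cell_pow_kernel_bounds:
  shows "cell pow_kernel i j \<ge> K * (1 - K) * (real (Suc i) powr p + real (Suc j) powr p) powr (K - 2)
           * (real (Suc i) powr p - real i powr p) * (real (Suc j) powr p - real j powr p)"
    and "0 < i \<Longrightarrow> cell pow_kernel i j \<le> K * (1 - K) * (real i powr p + real j powr p) powr (K - 2)
           * (real (Suc i) powr p - real i powr p) * (real (Suc j) powr p - real j powr p)"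
    and "0 \<le> cell pow_kernel i j"
proof -
  define D where "D = (real (Suc i) powr p - real i powr p) * (real (Suc j) powr p - real j powr p)"
  have lt: "real i powr p < real (Suc i) powr p" "real j powr p < real (Suc j) powr p"
    using p by (auto intro!: powr_less_mono2)
  then have D: "0 \<le> D" by (simp add: D_def)
  obtain z where z: "real i powr p + real j powr p < z" "z < real (Suc i) powr p + real (Suc j) powr p"
    "cell pow_kernel i j = K * (1 - K) * z powr (K - 2) * D"
    by (rule powr_mixed_difference[OF K _ lt(1) _ lt(2)]) (auto simp: cell_def pow_kernel_def D_def mult.assoc)
  have z0: "0 < z" using z(1) by (smt (verit) powr_ge_zero)
  show "cell pow_kernel i j \<ge> K * (1 - K) * (real (Suc i) powr p + real (Suc j) powr p) powr (K - 2)
           * (real (Suc i) powr p - real i powr p) * (real (Suc j) powr p - real j powr p)"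
    unfolding z(3) mult.assoc[of _ "_ - _" "_ - _"] D_def[symmetric]
    using z(2) z0 K D by (intro mult_right_mono mult_left_mono powr_mono2') auto
  show "cell pow_kernel i j \<le> K * (1 - K) * (real i powr p + real j powr p) powr (K - 2)
           * (real (Suc i) powr p - real i powr p) * (real (Suc j) powr p - real j powr p)" if "0 < i"
    unfolding z(3) mult.assoc[of _ "_ - _" "_ - _"] D_def[symmetric]
    using z(1) that K D by (intro mult_right_mono mult_left_mono powr_mono2' add_pos_nonneg) auto
  show "0 \<le> cell pow_kernel i j"
    unfolding z(3) using K D by simp
qed

lemma pow_density_nonneg: "0 \<le> pow_density x y"
  using p K by (simp add: pow_density_def)

lemma powr_increment_bounds:
  fixes x :: real
  assumes "0 < x"
  shows "p * x powr (p - 1) \<le> (x + 1) powr p - x powr p" "(x + 1) powr p - x powr p \<le> p * (x + 1) powr (p - 1)"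
proof -
  have "((\<lambda>y. y powr p) has_real_derivative p * y powr (p - 1)) (at y)" if "x \<le> y" for y
    using assms that by (auto intro!: derivative_eq_intros)
  from MVT2[of x "x + 1", OF _ this] obtain z where
    "x < z" "z < x + 1" "(x + 1) powr p - x powr p = p * z powr (p - 1)" by auto
  with assms p show "p * x powr (p - 1) \<le> (x + 1) powr p - x powr p"
    "(x + 1) powr p - x powr p \<le> p * (x + 1) powr (p - 1)"
    by (auto intro!: powr_mono2)
qed

lemma powr_Suc_less: "real i powr p < real (Suc i) powr p"
  using p by (intro powr_less_mono2) auto

lemma ratio_tendsto: "ratio_below \<longlonglongrightarrow> 1" "ratio_above \<longlonglongrightarrow> 1"
proof -
  have pos: "0 < x powr (p - 1)" if "0 < x" for x :: real using that by simp
  show "ratio_below \<longlonglongrightarrow> 1"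
  proof (rule tendsto_sandwich)
    show "\<forall>\<^sub>F i in sequentially. 1 \<le> ratio_below i"
      using eventually_gt_at_top[of 0]
    proof eventually_elim
      case (elim i)
      then show ?case
        using powr_increment_bounds[of "real i"] powr_Suc_less[of i]
        by (simp add: ratio_below_def add.commute pos_le_divide_eq)
    qed
    show "\<forall>\<^sub>F i in sequentially. ratio_below i \<le> (real (Suc i) / real i) powr (p - 1)"
      using eventually_gt_at_top[of 0]
    proof eventually_elim
      case (elim i)
      then have "ratio_below i \<le> p * real (Suc i) powr (p - 1) / (p * real i powr (p - 1))"
        unfolding ratio_below_def using powr_increment_bounds[of "real i"] pos[of "real i"] powr_Suc_less[of i] p
        by (intro divide_left_mono) (simp_all add: add.commute)
      then show ?case using p by (simp add: powr_divide)
    qed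
    show "(\<lambda>i. (real (Suc i) / real i) powr (p - 1)) \<longlonglongrightarrow> 1" by real_asymp
  qed simp
  show "ratio_above \<longlonglongrightarrow> 1"
  proof (rule tendsto_sandwich)
    show "\<forall>\<^sub>F i in sequentially. ratio_above i \<le> 1"
    proof (intro always_eventually allI)
      fix i
      show "ratio_above i \<le> 1"
        using powr_increment_bounds[of "real (Suc i)"] powr_Suc_less[of "Suc i"]
        by (simp add: ratio_above_def add.commute pos_divide_le_eq)
    qed
    show "\<forall>\<^sub>F i in sequentially. (real (Suc i) / real (Suc (Suc i))) powr (p - 1) \<le> ratio_above i"
    proof (intro always_eventually allI)
      fix i
      have "p * real (Suc i) powr (p - 1) / (p * real (Suc (Suc i)) powr (p - 1)) \<le> ratio_above i"
        unfolding ratio_above_def using powr_increment_bounds[of "real (Suc i)"] pos[of "real (Suc i)"] powr_Suc_less[of "Suc i"] p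
        by (intro divide_left_mono) (simp_all add: add.commute)
      then show "(real (Suc i) / real (Suc (Suc i))) powr (p - 1) \<le> ratio_above i"
        using p by (simp add: powr_divide)
    qed
    show "(\<lambda>i. (real (Suc i) / real (Suc (Suc i))) powr (p - 1)) \<longlonglongrightarrow> 1" by real_asymp
  qed simp
qed

lemma ratio_nonneg: "0 \<le> ratio_below i" "0 \<le> ratio_above i"
  using p powr_Suc_less[of i] powr_Suc_less[of "Suc i"] unfolding ratio_below_def ratio_above_def
  by (simp_all del: of_nat_Suc)

text \<open>A bound for all \<open>i\<close>, including the small ones near the axes where the ratio
  is not yet close to 1. It rests on
  \<open>real i powr p \<le> real i * real (Suc i) powr (p - 1)\<close>, which keeps the increment
  above \<open>real (Suc i) powr (p - 1)\<close>.\<close>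

lemma ratio_below_le: "ratio_below i \<le> p"
proof -
  have "real i powr p \<le> real i * real (Suc i) powr (p - 1)"
  proof (cases "i = 0")
    case False
    then have "real i powr p = real i * real i powr (p - 1)"
      by (simp add: powr_diff)
    also have "\<dots> \<le> real i * real (Suc i) powr (p - 1)"
      using p by (intro mult_left_mono powr_mono2) auto
    finally show ?thesis .
  qed simp
  moreover have "real (Suc i) powr p = real (Suc i) * real (Suc i) powr (p - 1)"
    by (simp add: powr_diff)
  ultimately have "real (Suc i) powr (p - 1) \<le> real (Suc i) powr p - real i powr p"
    by (simp add: algebra_simps)
  then show ?thesis
    unfolding ratio_below_def using p powr_Suc_less[of i] by (subst pos_divide_le_eq) auto
qed

text \<open>The evaluation point is the upper corner of cell (i, j), where the decreasing factor is
  smallest; the ratios turn increments into derivatives.\<close>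

lemma pow_density_le: "pow_density (real (Suc i)) (real (Suc j)) \<le> ratio_below i * ratio_below j * cell pow_kernel i j"
proof -
  have lt: "real i powr p < real (Suc i) powr p" "real j powr p < real (Suc j) powr p"
    using p by (auto intro!: powr_less_mono2)
  then have "pow_density (real (Suc i)) (real (Suc j)) = ratio_below i * ratio_below j *
      (K * (1 - K) * (real (Suc i) powr p + real (Suc j) powr p) powr (K - 2)
           * (real (Suc i) powr p - real i powr p) * (real (Suc j) powr p - real j powr p))"
    unfolding pow_density_def ratio_below_def by (simp del: of_nat_Suc)
  also have "\<dots> \<le> ratio_below i * ratio_below j * cell pow_kernel i j"
    by (intro mult_left_mono cell_pow_kernel_bounds(1) mult_nonneg_nonneg ratio_nonneg)
  finally show ?thesis .
qed

text \<open>Now the evaluation point is the lower corner of the next cell, where the decreasing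
  factor is largest.\<close>

lemma pow_density_ge:
  "ratio_above i * ratio_above j * cell pow_kernel (i + 1) (j + 1) \<le> pow_density (real (Suc i)) (real (Suc j))"
proof -
  have lt: "real (Suc i) powr p < real (Suc (Suc i)) powr p" "real (Suc j) powr p < real (Suc (Suc j)) powr p"
    using p by (auto intro!: powr_less_mono2)
  have "ratio_above i * ratio_above j * cell pow_kernel (i + 1) (j + 1) \<le> ratio_above i * ratio_above j *
      (K * (1 - K) * (real (Suc i) powr p + real (Suc j) powr p) powr (K - 2)
           * (real (Suc (Suc i)) powr p - real (Suc i) powr p) * (real (Suc (Suc j)) powr p - real (Suc j) powr p))"
    using cell_pow_kernel_bounds(2)[of "Suc i" "Suc j"]
    by (intro mult_left_mono mult_nonneg_nonneg ratio_nonneg) (simp_all del: of_nat_Suc)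
  also have "\<dots> = pow_density (real (Suc i)) (real (Suc j))"
    unfolding pow_density_def ratio_above_def using lt by (simp del: of_nat_Suc)
  finally show ?thesis .
qed

text \<open>Sandwich between sums of cells: beyond an index \<open>m\<close> both correction factors
  are close to 1, and the rows and columns below \<open>m\<close> are negligible after
  scaling.\<close>

lemma sum_pow_density_tendsto:
  fixes P Q :: "nat \<Rightarrow> nat"
  assumes P: "(\<lambda>n. real (P n) / real n) \<longlonglongrightarrow> t" and Q: "(\<lambda>n. real (Q n) / real n) \<longlonglongrightarrow> s"
  shows "(\<lambda>n. real n powr (-a) * (\<Sum>i<P n. \<Sum>j<Q n. pow_density (real (Suc i)) (real (Suc j))))
    \<longlonglongrightarrow> pow_kernel 0 s + pow_kernel t 0 - pow_kernel t s"
    (is "_ \<longlonglongrightarrow> ?l")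
proof (rule tendsto_of_eps_bounds)
  fix e :: real assume e: "0 < e" "e < 1"
  define \<mu> where "\<mu> = cell pow_kernel"
  have \<mu>0: "0 \<le> \<mu> i j" for i j unfolding \<mu>_def by (rule cell_pow_kernel_bounds(3))
  have k00: "pow_kernel 0 0 = 0" by (simp add: pow_kernel_def)
  have const: "(\<lambda>n. real m / real n) \<longlonglongrightarrow> 0" for m by real_asymp
  have shift: "(\<lambda>n. real (X n + d) / real n) \<longlonglongrightarrow> x" if "(\<lambda>n. real (X n) / real n) \<longlonglongrightarrow> x" for X d x
    using tendsto_add[OF that const[of d]] by (simp add: add_divide_distrib)
  define MS where "MS d P Q = (\<Sum>i<P. \<Sum>j<Q. \<mu> (i + d) (j + d))" for d P Q :: nat
  have MS: "(\<lambda>n. real n powr (-a) * MS d (X n) (Y n)) \<longlonglongrightarrow> pow_kernel 0 y + pow_kernel x 0 - pow_kernel x y"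
    if "(\<lambda>n. real (X n) / real n) \<longlonglongrightarrow> x" "(\<lambda>n. real (Y n) / real n) \<longlonglongrightarrow> y" for d X Y x y
  proof -
    have "(\<lambda>n. real n powr (-a) * pow_kernel (real d) (real (Y n + d))
        + real n powr (-a) * pow_kernel (real (X n + d)) (real d)
        - real n powr (-a) * pow_kernel (real d) (real d)
        - real n powr (-a) * pow_kernel (real (X n + d)) (real (Y n + d)))
      \<longlonglongrightarrow> pow_kernel 0 y + pow_kernel x 0 - pow_kernel 0 0 - pow_kernel x y"
      by (intro tendsto_add tendsto_diff pow_kernel_scaled_tendsto shift that const of_nat_0_le_iff)
    then show ?thesis
      unfolding MS_def \<mu>_def sum_cell by (simp add: k00 algebra_simps)
  qed
  \<comment> \<open>A fixed number of rows or columns has limiting side length 0, and the telescoped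
    limit then cancels to 0.\<close>
  have strip: "(\<lambda>n. real n powr (-a) * MS d m (Q n)) \<longlonglongrightarrow> 0" "(\<lambda>n. real n powr (-a) * MS d (P n) m) \<longlonglongrightarrow> 0" for d m
    using MS[OF const Q] MS[OF P const] by (simp_all add: k00)
  have "\<exists>d>0. \<forall>x y::real. \<bar>x - 1\<bar> < d \<longrightarrow> \<bar>y - 1\<bar> < d \<longrightarrow> 1 - e \<le> x * y \<and> x * y \<le> 1 + e"
  proof (intro exI[of _ "e / 4"] conjI allI impI)
    fix x y :: real assume xy: "\<bar>x - 1\<bar> < e / 4" "\<bar>y - 1\<bar> < e / 4"
    have "\<bar>(x - 1) * (y - 1)\<bar> \<le> e / 4 * 1"
      unfolding abs_mult using xy e by (intro mult_mono) auto
    moreover have "x * y = 1 + (x - 1) + (y - 1) + (x - 1) * (y - 1)" by (simp add: algebra_simps)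
    ultimately show "1 - e \<le> x * y" "x * y \<le> 1 + e" using xy e by linarith+
  qed (use e in auto)
  then obtain d where d: "0 < d"
    "\<And>x y::real. \<bar>x - 1\<bar> < d \<Longrightarrow> \<bar>y - 1\<bar> < d \<Longrightarrow> 1 - e \<le> x * y \<and> x * y \<le> 1 + e" by blast
  have "\<forall>\<^sub>F i in sequentially. \<bar>ratio_below i - 1\<bar> < d \<and> \<bar>ratio_above i - 1\<bar> < d"
    using tendstoD[OF ratio_tendsto(1) d(1)] tendstoD[OF ratio_tendsto(2) d(1)]
    by (auto simp: dist_real_def eventually_conj_iff)
  then obtain m where m: "\<And>i. m \<le> i \<Longrightarrow> \<bar>ratio_below i - 1\<bar> < d" "\<And>i. m \<le> i \<Longrightarrow> \<bar>ratio_above i - 1\<bar> < d"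
    by (auto simp: eventually_sequentially)
  define W where "W i j = pow_density (real (Suc i)) (real (Suc j))" for i j
  \<comment> \<open>On the two strips the crude factor \<open>p\<^sup>2\<close> replaces
    \<open>1 + e\<close>. Counting the overlap of the strips twice does no harm, as all terms are
    nonnegative.\<close>
  have upper: "W i j \<le> (1 + e) * \<mu> i j + (if i < m then p\<^sup>2 * \<mu> i j else 0) + (if j < m then p\<^sup>2 * \<mu> i j else 0)" for i j
  proof (cases "i < m \<or> j < m")
    case True
    have "W i j \<le> ratio_below i * ratio_below j * \<mu> i j"
      unfolding W_def \<mu>_def by (rule pow_density_le)
    also have "\<dots> \<le> p * p * \<mu> i j"
      using p by (intro mult_right_mono mult_mono \<mu>0 ratio_below_le ratio_nonneg) auto
    finally have "W i j \<le> p\<^sup>2 * \<mu> i j" by (simp add: power2_eq_square)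
    moreover have "0 \<le> (1 + e) * \<mu> i j" "0 \<le> p\<^sup>2 * \<mu> i j" using e \<mu>0 by auto
    ultimately show ?thesis using True by (smt (verit))
  next
    case False
    have "W i j \<le> ratio_below i * ratio_below j * \<mu> i j"
      unfolding W_def \<mu>_def by (rule pow_density_le)
    also have "\<dots> \<le> (1 + e) * \<mu> i j"
      using d(2)[OF m(1) m(1), of i j] False by (intro mult_right_mono \<mu>0) auto
    finally show ?thesis using False by simp
  qed
  \<comment> \<open>On the strips a whole cell is subtracted, so the left side is at most 0 and the
    nonnegativity of the density suffices.\<close>
  have lower: "(1 - e) * \<mu> (i + 1) (j + 1) - (if i < m then \<mu> (i + 1) (j + 1) else 0)
      - (if j < m then \<mu> (i + 1) (j + 1) else 0) \<le> W i j" for i j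
  proof (cases "i < m \<or> j < m")
    case True
    have "0 \<le> e * \<mu> (i + 1) (j + 1)" using e \<mu>0 by simp
    then have "(1 - e) * \<mu> (i + 1) (j + 1) \<le> \<mu> (i + 1) (j + 1)" by (simp add: algebra_simps)
    moreover have "0 \<le> W i j" unfolding W_def by (rule pow_density_nonneg)
    ultimately show ?thesis using True \<mu>0[of "i + 1" "j + 1"] by (smt (verit))
  next
    case False
    have "(1 - e) * \<mu> (i + 1) (j + 1) \<le> ratio_above i * ratio_above j * \<mu> (i + 1) (j + 1)"
      using d(2)[OF m(2) m(2), of i j] False by (intro mult_right_mono \<mu>0) auto
    also have "\<dots> \<le> W i j" unfolding W_def \<mu>_def by (rule pow_density_ge)
    finally show ?thesis using False by simp
  qed
  have cut: "(\<Sum>i<X. if i < m then f i else 0) \<le> (\<Sum>i<m. f i)" if "\<And>i. 0 \<le> f i" for X and f :: "nat \<Rightarrow> real"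
  proof -
    have "(\<Sum>i<X. if i < m then f i else 0) = (\<Sum>i\<in>{..<X} \<inter> {i. i < m}. f i)"
      by (simp add: sum.If_cases)
    also have "\<dots> \<le> (\<Sum>i<m. f i)" using that by (intro sum_mono2) auto
    finally show ?thesis .
  qed
  have strip_le: "(\<Sum>i<X. \<Sum>j<Y. if i < m then \<mu> (i + d) (j + d) else 0) \<le> MS d m Y"
    "(\<Sum>i<X. \<Sum>j<Y. if j < m then \<mu> (i + d) (j + d) else 0) \<le> MS d X m" for X Y d
  proof -
    have "(\<Sum>i<X. \<Sum>j<Y. if i < m then \<mu> (i + d) (j + d) else 0) =
        (\<Sum>i<X. if i < m then (\<Sum>j<Y. \<mu> (i + d) (j + d)) else 0)"
      by (intro sum.cong) auto
    then show "(\<Sum>i<X. \<Sum>j<Y. if i < m then \<mu> (i + d) (j + d) else 0) \<le> MS d m Y"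
      unfolding MS_def using cut[of "\<lambda>i. \<Sum>j<Y. \<mu> (i + d) (j + d)" X] \<mu>0 by (simp add: sum_nonneg)
    show "(\<Sum>i<X. \<Sum>j<Y. if j < m then \<mu> (i + d) (j + d) else 0) \<le> MS d X m"
      unfolding MS_def by (intro sum_mono cut \<mu>0)
  qed
  have U: "(\<Sum>i<X. \<Sum>j<Y. W i j) \<le> (1 + e) * MS 0 X Y + p\<^sup>2 * MS 0 m Y + p\<^sup>2 * MS 0 X m" for X Y
  proof -
    have "(\<Sum>i<X. \<Sum>j<Y. W i j) \<le> (\<Sum>i<X. \<Sum>j<Y. (1 + e) * \<mu> i j
        + p\<^sup>2 * (if i < m then \<mu> i j else 0) + p\<^sup>2 * (if j < m then \<mu> i j else 0))"
      using upper by (intro sum_mono) (simp add: if_distrib cong: if_cong)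
    also have "\<dots> = (1 + e) * MS 0 X Y + p\<^sup>2 * (\<Sum>i<X. \<Sum>j<Y. if i < m then \<mu> i j else 0)
        + p\<^sup>2 * (\<Sum>i<X. \<Sum>j<Y. if j < m then \<mu> i j else 0)"
      by (simp add: sum.distrib sum_distrib_left MS_def)
    also have "\<dots> \<le> (1 + e) * MS 0 X Y + p\<^sup>2 * MS 0 m Y + p\<^sup>2 * MS 0 X m"
      using strip_le[where X=X and Y=Y and d=0, unfolded add_0_right]
      by (intro add_mono order_refl mult_left_mono) simp_all
    finally show ?thesis .
  qed
  have L: "(1 - e) * MS 1 X Y - MS 1 m Y - MS 1 X m \<le> (\<Sum>i<X. \<Sum>j<Y. W i j)" for X Y
  proof -
    have "(1 - e) * MS 1 X Y - MS 1 m Y - MS 1 X m \<le> (1 - e) * MS 1 X Y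
        - (\<Sum>i<X. \<Sum>j<Y. if i < m then \<mu> (i + 1) (j + 1) else 0)
        - (\<Sum>i<X. \<Sum>j<Y. if j < m then \<mu> (i + 1) (j + 1) else 0)"
      using strip_le[where X=X and Y=Y and d=1] by linarith
    also have "\<dots> = (\<Sum>i<X. \<Sum>j<Y. (1 - e) * \<mu> (i + 1) (j + 1) - (if i < m then \<mu> (i + 1) (j + 1) else 0)
      - (if j < m then \<mu> (i + 1) (j + 1) else 0))"
      by (simp add: sum_subtractf sum_distrib_left MS_def)
    also have "\<dots> \<le> (\<Sum>i<X. \<Sum>j<Y. W i j)" by (intro sum_mono lower)
    finally show ?thesis .
  qed
  let ?N = "\<lambda>n. real n powr (-a)"
  have "(\<lambda>n. (1 - e) * (?N n * MS 1 (P n) (Q n)) - ?N n * MS 1 m (Q n) - ?N n * MS 1 (P n) m) \<longlonglongrightarrow> (1 - e) * ?l - 0 - 0"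
    by (intro tendsto_diff tendsto_mult[OF tendsto_const] MS P Q strip)
  moreover have "(\<lambda>n. (1 + e) * (?N n * MS 0 (P n) (Q n)) + p\<^sup>2 * (?N n * MS 0 m (Q n)) + p\<^sup>2 * (?N n * MS 0 (P n) m))
      \<longlonglongrightarrow> (1 + e) * ?l + p\<^sup>2 * 0 + p\<^sup>2 * 0"
    by (intro tendsto_add tendsto_mult[OF tendsto_const] MS P Q strip)
  moreover have "(1 - e) * (?N n * MS 1 (P n) (Q n)) - ?N n * MS 1 m (Q n) - ?N n * MS 1 (P n) m
      \<le> ?N n * (\<Sum>i<P n. \<Sum>j<Q n. W i j)" for n
    using mult_left_mono[OF L[where X="P n" and Y="Q n"], of "?N n"] by (simp add: algebra_simps)
  moreover have "?N n * (\<Sum>i<P n. \<Sum>j<Q n. W i j) \<le>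
      (1 + e) * (?N n * MS 0 (P n) (Q n)) + p\<^sup>2 * (?N n * MS 0 m (Q n)) + p\<^sup>2 * (?N n * MS 0 (P n) m)" for n
    using mult_left_mono[OF U[where X="P n" and Y="Q n"], of "?N n"] by (simp add: algebra_simps)
  ultimately show "\<exists>A B. A \<longlonglongrightarrow> (1 - e) * ?l \<and> B \<longlonglongrightarrow> (1 + e) * ?l \<and>
      (\<forall>\<^sub>F n in sequentially. A n \<le> ?N n * (\<Sum>i<P n. \<Sum>j<Q n. pow_density (real (Suc i)) (real (Suc j))) \<and>
        ?N n * (\<Sum>i<P n. \<Sum>j<Q n. pow_density (real (Suc i)) (real (Suc j))) \<le> B n)"
    unfolding W_def by (intro exI conjI always_eventually allI) simp_all
qed

text \<open>On the diagonal the powers of \<open>x\<close> combine to \<open>x powr (a - 2)\<close>,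
  at most 1 for \<open>a < 2\<close> and \<open>x \<ge> 1\<close>; the remaining constants are
  estimated by \<open>p\<^sup>2\<close>.\<close>

lemma pow_density_diag_le:
  assumes "a < 2" "1 \<le> x"
  shows "pow_density x x \<le> p\<^sup>2"
proof -
  have "(x powr p + x powr p) powr (K - 2) \<le> (x powr p) powr (K - 2)"
    using assms K by (intro powr_mono2') auto
  then have "pow_density x x \<le> K * (1 - K) * (x powr p) powr (K - 2) * (p * x powr (p - 1)) * (p * x powr (p - 1))"
    unfolding pow_density_def using p K by (intro mult_right_mono mult_left_mono) auto
  also have "\<dots> = K * (1 - K) * p\<^sup>2 * ((x powr p) powr (K - 2) * x powr (p - 1) * x powr (p - 1))"
    by (simp add: power2_eq_square)
  also have "(x powr p) powr (K - 2) * x powr (p - 1) * x powr (p - 1) = x powr (a - 2)"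
    by (simp add: powr_powr a_def flip: powr_add) (simp add: algebra_simps)
  also have "K * (1 - K) * p\<^sup>2 * x powr (a - 2) \<le> 1 * 1 * p\<^sup>2 * 1"
    using K assms powr_mono[of "a - 2" 0 x] by (intro mult_mono mult_nonneg_nonneg) auto
  finally show ?thesis by simp
qed

end

end

section \<open>The kernel |x - y|^a and its second differences\<close>

context
  fixes a :: real
begin

text \<open>Intended for \<open>m \<ge> 1\<close>; at \<open>m = 0\<close> the base
  \<open>real m - 1\<close> is negative, and \<open>cell_abs_diff\<close> gives the diagonal its own
  value.\<close>

definition second_diff :: "nat \<Rightarrow> real" where
  "second_diff m = (real m + 1) powr a + (real m - 1) powr a - 2 * real m powr a"

definition second_diff_error :: "nat \<Rightarrow> real" where
  "second_diff_error m = \<bar>a * (a - 1) * real m powr (a - 2) - second_diff m\<bar>"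

context
  assumes a: "1 < a" "a < 2"
begin

text \<open>By the mean value theorem the second difference is a value of the decreasing second derivative, so
  the errors telescope.\<close>

lemma second_diff_error_le:
  "second_diff_error (m + 2) \<le> a * (a - 1) * real (m + 1) powr (a - 2) - a * (a - 1) * real (m + 3) powr (a - 2)"
proof -
  define x where "x = real (m + 2)"
  have x: "2 \<le> x" by (simp add: x_def)
  have "((\<lambda>y. (y + 1) powr a - y powr a) has_real_derivative
      a * (y + 1) powr (a - 1) - a * y powr (a - 1)) (at y)" if "x - 1 \<le> y" for y
    using that x by (auto intro!: derivative_eq_intros)
  from MVT2[of "x - 1" x, OF _ this] obtain y where y: "x - 1 < y" "y < x"
    "(x + 1) powr a - x powr a - (x powr a - (x - 1) powr a) = a * (y + 1) powr (a - 1) - a * y powr (a - 1)"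
    by auto
  have "((\<lambda>z. a * z powr (a - 1)) has_real_derivative a * (a - 1) * z powr (a - 2)) (at z)" if "y \<le> z" for z
    using that x y by (auto intro!: derivative_eq_intros)
  from MVT2[of y "y + 1", OF _ this] obtain z where z: "y < z" "z < y + 1"
    "a * (y + 1) powr (a - 1) - a * y powr (a - 1) = a * (a - 1) * z powr (a - 2)" by auto
  have sd: "second_diff (m + 2) = a * (a - 1) * z powr (a - 2)"
    using y(3) z(3) by (simp add: second_diff_def x_def algebra_simps)
  have mono: "a * (a - 1) * v powr (a - 2) \<le> a * (a - 1) * u powr (a - 2)" if "1 \<le> u" "u \<le> v" for u v
    using that a by (intro mult_left_mono powr_mono2') auto
  have eq: "real (m + 1) = x - 1" "real (m + 3) = x + 1" by (simp_all add: x_def)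
  have "a * (a - 1) * x powr (a - 2) \<le> a * (a - 1) * (x - 1) powr (a - 2)"
    "a * (a - 1) * (x + 1) powr (a - 2) \<le> a * (a - 1) * x powr (a - 2)"
    "a * (a - 1) * z powr (a - 2) \<le> a * (a - 1) * (x - 1) powr (a - 2)"
    "a * (a - 1) * (x + 1) powr (a - 2) \<le> a * (a - 1) * z powr (a - 2)"
    using x y z by (auto intro!: mono)
  then show ?thesis
    unfolding second_diff_error_def sd x_def[symmetric] eq by (intro abs_leI) linarith+
qed

text \<open>The bounds \<open>f (m + 1) - f (m + 3)\<close> telescope with gap two and leave
  \<open>f 1 + f 2\<close>. The indices 0 and 1 are added by hand: the estimate starts at 2, where
  the left neighbour is still positive.\<close>

lemma sum_second_diff_error_le:
  "\<exists>C. \<forall>N. (\<Sum>m<N. second_diff_error m) \<le> C"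
proof -
  define f where "f x = a * (a - 1) * real x powr (a - 2)" for x :: nat
  have f0: "0 \<le> f x" for x using a by (simp add: f_def)
  have "(\<Sum>m<N. second_diff_error (m + 2)) \<le> f 1 + f 2 - f (N + 1) - f (N + 2)" for N
  proof (induction N)
    case (Suc N)
    then show ?case
      using second_diff_error_le[of N] by (simp add: f_def numeral_3_eq_3 numeral_2_eq_2)
  qed (simp add: numeral_2_eq_2)
  then have *: "(\<Sum>m<N. second_diff_error (m + 2)) \<le> f 1 + f 2" for N
    using f0[of "N + 1"] f0[of "N + 2"] by (smt (verit))
  have "(\<Sum>m<N. second_diff_error m) \<le> second_diff_error 0 + second_diff_error 1 + (f 1 + f 2)" for N
  proof -
    have "(\<Sum>m<N. second_diff_error m) \<le> (\<Sum>m<Suc (Suc N). second_diff_error m)"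
      by (intro sum_mono2) (auto simp: second_diff_error_def)
    also have "\<dots> = second_diff_error 0 + second_diff_error 1 + (\<Sum>m<N. second_diff_error (m + 2))"
      unfolding sum.lessThan_Suc_shift by simp
    finally show ?thesis using *[of N] by simp
  qed
  then show ?thesis by blast
qed

lemma cell_abs_diff:
  "cell (\<lambda>x y. \<bar>x - y\<bar> powr a) i j = (if i = j then 2 else second_diff (nat \<bar>int i - int j\<bar>))"
proof -
  define m where "m = nat \<bar>int i - int j\<bar>"
  consider "i = j" | "i < j" | "j < i" by linarith
  then show ?thesis
  proof cases
    case 2
    then have d: "\<bar>real i - real (Suc j)\<bar> = real m + 1" "\<bar>real (Suc i) - real j\<bar> = real m - 1"
      "\<bar>real (Suc i) - real (Suc j)\<bar> = real m" "\<bar>real i - real j\<bar> = real m"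
      by (auto simp: m_def)
    show ?thesis
      unfolding cell_def d m_def[symmetric] second_diff_def using 2 by simp
  next
    case 3
    then have d: "\<bar>real i - real (Suc j)\<bar> = real m - 1" "\<bar>real (Suc i) - real j\<bar> = real m + 1"
      "\<bar>real (Suc i) - real (Suc j)\<bar> = real m" "\<bar>real i - real j\<bar> = real m"
      by (auto simp: m_def)
    show ?thesis
      unfolding cell_def d m_def[symmetric] second_diff_def using 3 by simp
  qed (simp add: cell_def)
qed

lemma sum_cell_abs_diff_tendsto:
  fixes P Q :: "nat \<Rightarrow> nat"
  assumes P: "(\<lambda>n. real (P n) / real n) \<longlonglongrightarrow> t" and Q: "(\<lambda>n. real (Q n) / real n) \<longlonglongrightarrow> s"
    and "0 \<le> t" "0 \<le> s"
  shows "(\<lambda>n. real n powr (-a) * (\<Sum>i<P n. \<Sum>j<Q n. cell (\<lambda>x y. \<bar>x - y\<bar> powr a) i j))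
    \<longlonglongrightarrow> s powr a + t powr a - \<bar>t - s\<bar> powr a"
proof -
  have "(\<lambda>n. (real (Q n) / real n) powr a + (real (P n) / real n) powr a
      - \<bar>real (P n) / real n - real (Q n) / real n\<bar> powr a) \<longlonglongrightarrow> s powr a + t powr a - \<bar>t - s\<bar> powr a"
    using a by (intro tendsto_add tendsto_diff tendsto_powr' tendsto_rabs P Q tendsto_const disjI2 conjI) auto
  moreover have "\<forall>\<^sub>F n in sequentially. (real (Q n) / real n) powr a + (real (P n) / real n) powr a
      - \<bar>real (P n) / real n - real (Q n) / real n\<bar> powr a =
      real n powr (-a) * (\<Sum>i<P n. \<Sum>j<Q n. cell (\<lambda>x y. \<bar>x - y\<bar> powr a) i j)"
    using eventually_gt_at_top[of 0]
  proof eventually_elim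
    case (elim n)
    have "\<bar>real (P n) / real n - real (Q n) / real n\<bar> powr a = \<bar>real (P n) - real (Q n)\<bar> powr a / real n powr a"
      by (simp add: powr_divide flip: diff_divide_distrib)
    moreover have "(real (P n) / real n) powr a = real (P n) powr a / real n powr a"
      "(real (Q n) / real n) powr a = real (Q n) powr a / real n powr a"
      by (simp_all add: powr_divide)
    ultimately show ?case
      unfolding sum_cell_0 by (simp only:) (simp add: powr_minus field_simps add_divide_distrib diff_divide_distrib)
  qed
  ultimately show ?thesis by (rule Lim_transform_eventually)
qed

end

end

text \<open>\<open>c\<close> is compared entrywise with \<open>k * (V - W)\<close>. The telescoping
  lemma gives the limit for \<open>V\<close>, the sandwich the limit for \<open>W\<close>, and the
  difference is bounded by a summable function of |i - j|.\<close>

lemma covariance_sum_tendsto: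
  fixes p K a :: real and c :: "nat \<Rightarrow> nat \<Rightarrow> real" and P Q :: "nat \<Rightarrow> nat"
  assumes p: "1 < p" and K: "0 < K" "K < 1" and a: "a = p * K" "1 < a" "a < 2"
    and diag: "\<And>i. c i i = 1"
    and off: "\<And>i j. i \<noteq> j \<Longrightarrow> c i j = 2 powr (-K) *
        (a * (a - 1) * \<bar>real i - real j\<bar> powr (a - 2) - pow_density p K (real (Suc i)) (real (Suc j)))"
    and P: "(\<lambda>n. real (P n) / real n) \<longlonglongrightarrow> t" and Q: "(\<lambda>n. real (Q n) / real n) \<longlonglongrightarrow> s"
    and ts: "0 \<le> t" "0 \<le> s"
  shows "(\<lambda>n. real n powr (-a) * (\<Sum>i<P n. \<Sum>j<Q n. c i j))
    \<longlonglongrightarrow> 2 powr (-K) * ((t powr p + s powr p) powr K - \<bar>t - s\<bar> powr a)"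
proof -
  define W where "W i j = pow_density p K (real (Suc i)) (real (Suc j))" for i j
  define V where "V i j = cell (\<lambda>x y. \<bar>x - y\<bar> powr a) i j" for i j
  define k where "k = 2 powr (-K)"
  have k: "0 \<le> k" "k \<le> 1"
    using K powr_mono[of "-K" 0 2] by (simp_all add: k_def)
  \<comment> \<open>On the diagonal, \<open>c\<close> contributes 1 and
    \<open>k * (2 - W i i)\<close> at most \<open>2 + p\<^sup>2\<close>, whence
    \<open>3 + p\<^sup>2\<close>.\<close>
  define r where "r m = (if m = 0 then 3 + p\<^sup>2 else second_diff_error a m)" for m
  have r0: "0 \<le> r m" for m by (simp add: r_def second_diff_error_def)
  obtain C where C: "\<And>N. (\<Sum>m<N. second_diff_error a m) \<le> C"
    using sum_second_diff_error_le[OF a(2,3)] by blast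
  have rC: "(\<Sum>m<N. r m) \<le> 3 + p\<^sup>2 + C" for N
  proof -
    have "(\<Sum>m<N. r m) \<le> (\<Sum>m<N. (if m = 0 then 3 + p\<^sup>2 else 0) + second_diff_error a m)"
      by (intro sum_mono) (auto simp: r_def second_diff_error_def)
    also have "\<dots> \<le> 3 + p\<^sup>2 + C"
      unfolding sum.distrib using C[of N] by (intro add_mono) auto
    finally show ?thesis .
  qed
  have err: "\<bar>c i j - k * (V i j - W i j)\<bar> \<le> r (nat \<bar>int i - int j\<bar>)" for i j
  proof (cases "i = j")
    case True
    have "0 \<le> W i i" "W i i \<le> p\<^sup>2"
      unfolding W_def using pow_density_nonneg[OF p K a(1,2)] pow_density_diag_le[OF p K a(1,2,3), of "real (Suc i)"] by auto
    then have "\<bar>k * (2 - W i i)\<bar> \<le> 1 * (2 + p\<^sup>2)"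
      unfolding abs_mult using k by (intro mult_mono) auto
    then show ?thesis
      using True by (simp add: V_def cell_abs_diff[OF a(2,3)] diag r_def abs_le_iff)
  next
    case False
    define m where "m = nat \<bar>int i - int j\<bar>"
    have m: "\<bar>real i - real j\<bar> = real m" "m \<noteq> 0" using False by (auto simp: m_def)
    have "c i j - k * (V i j - W i j) = k * (a * (a - 1) * real m powr (a - 2) - second_diff a m)"
      using False m(1) by (simp add: V_def W_def k_def cell_abs_diff[OF a(2,3)] off m_def[symmetric] algebra_simps)
    then have "\<bar>c i j - k * (V i j - W i j)\<bar> = k * second_diff_error a m"
      using k by (simp add: abs_mult second_diff_error_def)
    also have "\<dots> \<le> 1 * second_diff_error a m"
      using k by (intro mult_right_mono) (auto simp: second_diff_error_def)
    finally show ?thesis using m(2) by (simp add: r_def m_def)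
  qed
  define E where "E n = real n powr (-a) * (\<Sum>i<P n. \<Sum>j<Q n. c i j - k * (V i j - W i j))" for n
  have "E \<longlonglongrightarrow> 0"
  proof (rule Lim_null_comparison)
    \<comment> \<open>The error sum is at most a constant times \<open>P n\<close>, and
      \<open>P n / n\<close> converges; the factor left over tends to 0 because
      \<open>a > 1\<close>.\<close>
    have "(\<lambda>n. real n powr (1 - a)) \<longlonglongrightarrow> 0" using a(2) by real_asymp
    from tendsto_mult[OF tendsto_mult[OF P this] tendsto_const[of "2 * (3 + p\<^sup>2 + C)"]]
    show "(\<lambda>n. real (P n) / real n * real n powr (1 - a) * (2 * (3 + p\<^sup>2 + C))) \<longlonglongrightarrow> 0" by simp
    show "\<forall>\<^sub>F n in sequentially. norm (E n) \<le> real (P n) / real n * real n powr (1 - a) * (2 * (3 + p\<^sup>2 + C))"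
      using eventually_gt_at_top[of 0]
    proof eventually_elim
      case (elim n)
      have "\<bar>\<Sum>i<P n. \<Sum>j<Q n. c i j - k * (V i j - W i j)\<bar> \<le> (\<Sum>i<P n. \<Sum>j<Q n. r (nat \<bar>int i - int j\<bar>))"
        by (intro order_trans[OF sum_abs] sum_mono err)
      also have "\<dots> \<le> (\<Sum>i<P n. 2 * (3 + p\<^sup>2 + C))"
        by (intro sum_mono sum_abs_diff_le r0 rC)
      finally have "norm (E n) \<le> real n powr (-a) * (real (P n) * (2 * (3 + p\<^sup>2 + C)))"
        unfolding E_def by (simp add: abs_mult mult_left_mono)
      also have "real n powr (-a) = real n powr (1 - a) / real n"
        using elim by (simp add: powr_diff powr_minus field_simps)
      finally show ?case by (simp add: mult_ac)
    qed
  qed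
  moreover have "(\<lambda>n. k * (real n powr (-a) * (\<Sum>i<P n. \<Sum>j<Q n. V i j)
      - real n powr (-a) * (\<Sum>i<P n. \<Sum>j<Q n. W i j)))
      \<longlonglongrightarrow> k * ((s powr a + t powr a - \<bar>t - s\<bar> powr a)
          - (pow_kernel p K 0 s + pow_kernel p K t 0 - pow_kernel p K t s))"
    unfolding V_def W_def
    by (intro tendsto_mult tendsto_diff tendsto_const sum_cell_abs_diff_tendsto[OF a(2,3) P Q ts]
        sum_pow_density_tendsto[OF p K a(1,2) P Q])
  ultimately have "(\<lambda>n. E n + k * (real n powr (-a) * (\<Sum>i<P n. \<Sum>j<Q n. V i j)
      - real n powr (-a) * (\<Sum>i<P n. \<Sum>j<Q n. W i j)))
      \<longlonglongrightarrow> 0 + k * ((s powr a + t powr a - \<bar>t - s\<bar> powr a)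
          - (pow_kernel p K 0 s + pow_kernel p K t 0 - pow_kernel p K t s))"
    by (rule tendsto_add)
  moreover have "E n + k * (real n powr (-a) * (\<Sum>i<P n. \<Sum>j<Q n. V i j)
      - real n powr (-a) * (\<Sum>i<P n. \<Sum>j<Q n. W i j)) = real n powr (-a) * (\<Sum>i<P n. \<Sum>j<Q n. c i j)" for n
  proof -
    have "(\<Sum>i<P n. \<Sum>j<Q n. c i j - k * (V i j - W i j)) =
        (\<Sum>i<P n. \<Sum>j<Q n. c i j) - k * ((\<Sum>i<P n. \<Sum>j<Q n. V i j) - (\<Sum>i<P n. \<Sum>j<Q n. W i j))"
      by (simp add: sum_subtractf sum_distrib_left right_diff_distrib)
    note eq = this
    show ?thesis unfolding E_def eq by (simp add: algebra_simps)
  qed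
  \<comment> \<open>\<open>pow_kernel p K 0 s\<close> is \<open>s powr a\<close>, so the boundary
    terms of the two telescoped sums cancel.\<close>
  moreover have "0 + k * ((s powr a + t powr a - \<bar>t - s\<bar> powr a)
          - (pow_kernel p K 0 s + pow_kernel p K t 0 - pow_kernel p K t s))
      = 2 powr (-K) * ((t powr p + s powr p) powr K - \<bar>t - s\<bar> powr a)"
    by (simp add: pow_kernel_def powr_powr a(1) k_def)
  ultimately show ?thesis by simp
qed

subsection \<open>Centered normal random variables\<close>

text \<open>Phrased by characteristic functions so that variance 0 is no special case and
  independent sums and almost sure limits are immediate.\<close>

definition centered_normal :: "'a measure \<Rightarrow> ('a \<Rightarrow> real) \<Rightarrow> real \<Rightarrow> bool" where
  "centered_normal M X v \<longleftrightarrow> X \<in> borel_measurable M \<and> 0 \<le> v \<and>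
     (\<forall>u. char (distr M borel X) u = of_real (exp (- (v * u\<^sup>2) / 2)))"

lemma centered_normal_measurable: "centered_normal M X v \<Longrightarrow> X \<in> borel_measurable M"
  by (simp add: centered_normal_def)

context prob_space
begin

lemma char_distr_eq:
  assumes "X \<in> borel_measurable M"
  shows "char (distr M borel X) u = (CLINT \<omega>|M. iexp (u * X \<omega>))"
  using assms by (simp add: char_def integral_distr)

lemma real_distribution_distr_borel:
  assumes "X \<in> borel_measurable M"
  shows "real_distribution (distr M borel X)"
proof -
  interpret D: prob_space "distr M borel X" by (rule prob_space_distr[OF assms])
  show ?thesis by unfold_locales auto
qed

lemma centered_normal_density:
  assumes \<sigma>: "0 < \<sigma>" and X: "distributed M lborel X (normal_density 0 \<sigma>)"
  shows "centered_normal M X (\<sigma>\<^sup>2)"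
proof -
  have m [measurable]: "X \<in> borel_measurable M"
    using distributed_measurable[OF X] by simp
  have "distributed M lborel (\<lambda>x. X x / \<sigma>) std_normal_density"
    using X normal_standard_normal_convert[OF \<sigma>, of X 0] by simp
  from distributed_distr_eq_density[OF this]
  have D: "distr M borel (\<lambda>x. X x / \<sigma>) = std_normal_distribution"
    by (simp cong: distr_cong)
  have "char (distr M borel X) u = of_real (exp (- (\<sigma>\<^sup>2 * u\<^sup>2) / 2))" for u
  proof -
    have "char (distr M borel X) u = char (distr M borel (\<lambda>x. X x / \<sigma>)) (u * \<sigma>)"
      using \<sigma> by (simp add: char_distr_eq)
    also have "\<dots> = of_real (exp (- (\<sigma>\<^sup>2 * u\<^sup>2) / 2))"
      unfolding D char_std_normal_distribution by (simp add: power_mult_distrib mult.commute)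
    finally show ?thesis .
  qed
  with m show ?thesis by (simp add: centered_normal_def)
qed

lemma centered_normal_AE_0:
  assumes m [measurable]: "X \<in> borel_measurable M" and X: "AE \<omega> in M. X \<omega> = 0"
  shows "centered_normal M X 0"
proof -
  have "char (distr M borel X) u = 1" for u
  proof -
    have "(CLINT \<omega>|M. iexp (u * X \<omega>)) = (CLINT \<omega>|M. 1)"
      by (rule integral_cong_AE) (use X in auto)
    then show ?thesis by (simp add: char_distr_eq prob_space)
  qed
  with m show ?thesis by (simp add: centered_normal_def)
qed

lemma normal_rv_imp_centered_normal:
  assumes X: "normal_rv M X" and mean: "expectation X = 0"
  shows "integrable M (\<lambda>\<omega>. (X \<omega>)\<^sup>2)" "centered_normal M X (expectation (\<lambda>\<omega>. (X \<omega>)\<^sup>2))"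
proof -
  have m [measurable]: "X \<in> borel_measurable M" using X by (simp add: normal_rv_def)
  have "integrable M (\<lambda>\<omega>. (X \<omega>)\<^sup>2) \<and> centered_normal M X (expectation (\<lambda>\<omega>. (X \<omega>)\<^sup>2))"
    using X unfolding normal_rv_def
  proof (elim conjE exE disjE)
    fix \<mu> assume AE: "AE \<omega> in M. X \<omega> = \<mu>"
    then have "expectation X = (\<integral>\<omega>. \<mu> \<partial>M)"
      by (intro integral_cong_AE) auto
    with mean have "\<mu> = 0" by (simp add: prob_space)
    with AE have X0: "AE \<omega> in M. X \<omega> = 0" by simp
    have "expectation (\<lambda>\<omega>. (X \<omega>)\<^sup>2) = (\<integral>\<omega>. 0 \<partial>M)"
      by (rule integral_cong_AE) (use X0 in auto)
    moreover have "integrable M (\<lambda>\<omega>. (X \<omega>)\<^sup>2) \<longleftrightarrow> integrable M (\<lambda>\<omega>. 0::real)"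
      by (rule integrable_cong_AE) (use X0 in auto)
    ultimately show ?thesis
      using centered_normal_AE_0[OF m X0] by simp
  next
    fix \<mu> \<sigma> :: real assume \<sigma>: "\<sigma> > 0" and D: "distributed M lborel X (normal_density \<mu> \<sigma>)"
    have "\<mu> = 0" using normal_distributed_expectation[OF \<sigma> D] mean by simp
    with D have D0: "distributed M lborel X (normal_density 0 \<sigma>)" by simp
    have "expectation (\<lambda>\<omega>. (X \<omega>)\<^sup>2) = \<sigma>\<^sup>2"
      using normal_distributed_variance[OF \<sigma> D] mean by simp
    moreover have "integrable M (\<lambda>\<omega>. (X \<omega>)\<^sup>2)"
      using distributed_integrable[OF D0, of "\<lambda>x. x\<^sup>2"] integrable_normal_moment[OF \<sigma>, of 0 2] by simp
    ultimately show ?thesis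
      using centered_normal_density[OF \<sigma> D0] by simp
  qed
  then show "integrable M (\<lambda>\<omega>. (X \<omega>)\<^sup>2)" "centered_normal M X (expectation (\<lambda>\<omega>. (X \<omega>)\<^sup>2))"
    by auto
qed

text \<open>Characteristic functions determine laws: \<open>X\<close> is compared with the constant
  0 if \<open>v = 0\<close>, and otherwise with the identity under the normal law of standard
  deviation \<open>sqrt v\<close>.\<close>

lemma centered_normal_imp_normal_rv:
  assumes "centered_normal M X v"
  shows "normal_rv M X" "expectation X = 0" "expectation (\<lambda>\<omega>. (X \<omega>)\<^sup>2) = v"
proof -
  have m [measurable]: "X \<in> borel_measurable M" and v: "0 \<le> v"
    and ch: "char (distr M borel X) = (\<lambda>u. of_real (exp (- (v * u\<^sup>2) / 2)))"
    using assms by (auto simp: centered_normal_def)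
  interpret X: real_distribution "distr M borel X"
    by (rule real_distribution_distr_borel[OF m])
  have "normal_rv M X \<and> expectation X = 0 \<and> expectation (\<lambda>\<omega>. (X \<omega>)\<^sup>2) = v"
  proof (cases "v = 0")
    case True
    interpret O: real_distribution "distr M borel (\<lambda>_. 0)"
      by (rule real_distribution_distr_borel) simp
    have "char (distr M borel (\<lambda>_. 0)) = char (distr M borel X)"
      unfolding ch by (rule ext) (simp add: char_distr_eq prob_space True del: distr_const)
    then have eq: "distr M borel (\<lambda>_. 0) = distr M borel X"
      by (intro Levy_uniqueness) (unfold_locales)
    have "AE x in distr M borel (\<lambda>_. 0). x = (0::real)"
      by (subst AE_distr_iff) auto
    then have X0: "AE \<omega> in M. X \<omega> = 0"
      unfolding eq by (subst (asm) AE_distr_iff) auto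
    have "expectation X = (\<integral>\<omega>. 0 \<partial>M)" "expectation (\<lambda>\<omega>. (X \<omega>)\<^sup>2) = (\<integral>\<omega>. 0 \<partial>M)"
      by (rule integral_cong_AE; use X0 in auto)+
    with X0 True show ?thesis by (auto simp: normal_rv_def)
  next
    case False
    with v have s: "0 < sqrt v" by simp
    define P where "P = density lborel (normal_density 0 (sqrt v))"
    interpret P: prob_space P
      unfolding P_def using s by (rule prob_space_normal_density)
    interpret P: real_distribution P by unfold_locales (auto simp: P_def)
    have dP: "distributed P lborel (\<lambda>x. x) (normal_density 0 (sqrt v))"
      unfolding distributed_def by (auto simp: P_def intro!: distr_id2[symmetric] distr_id2)
    have "distr P borel (\<lambda>x. x) = P"
      by (rule distr_id2) (simp add: P_def)
    then have "char P = char (distr M borel X)"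
      using P.centered_normal_density[OF s dP] v unfolding ch centered_normal_def by auto
    then have eq: "P = distr M borel X"
      by (intro Levy_uniqueness) (unfold_locales)
    have D: "distributed M lborel X (normal_density 0 (sqrt v))"
      unfolding distributed_def using eq by (auto simp: P_def cong: distr_cong)
    have "expectation X = 0" by (rule normal_distributed_expectation[OF s D])
    moreover from this have "expectation (\<lambda>\<omega>. (X \<omega>)\<^sup>2) = v"
      using normal_distributed_variance[OF s D] v by simp
    moreover have "normal_rv M X"
      using s D m unfolding normal_rv_def by blast
    ultimately show ?thesis by simp
  qed
  then show "normal_rv M X" "expectation X = 0" "expectation (\<lambda>\<omega>. (X \<omega>)\<^sup>2) = v"
    by auto
qed

lemma centered_normal_square_integrable:
  assumes "centered_normal M X v"
  shows "integrable M (\<lambda>\<omega>. (X \<omega>)\<^sup>2)"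
  using normal_rv_imp_centered_normal(1) centered_normal_imp_normal_rv[OF assms] by blast

lemma centered_normal_integrable:
  assumes "centered_normal M X v"
  shows "integrable M X"
  by (rule square_integrable_imp_integrable[OF centered_normal_measurable[OF assms]
        centered_normal_square_integrable[OF assms]])

text \<open>The real part of the characteristic function at 1 multiplied by the phase factor. The
  value depends on the variance alone, so convergence of covariances settles every wave of a
  trigonometric polynomial.\<close>

lemma centered_normal_expectation_cos:
  assumes "centered_normal M X v"
  shows "expectation (\<lambda>\<omega>. cos (X \<omega> + b)) = cos b * exp (- v / 2)"
proof -
  have m [measurable]: "X \<in> borel_measurable M"
    using assms by (rule centered_normal_measurable)
  have int: "integrable M (\<lambda>\<omega>. iexp (X \<omega>))"
    by (rule integrable_iexp) auto
  have "expectation (\<lambda>\<omega>. cos (X \<omega> + b)) = expectation (\<lambda>\<omega>. Re (iexp b * iexp (X \<omega>)))"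
    by (rule Bochner_Integration.integral_cong) (auto simp: Re_exp Im_exp cos_add)
  also have "\<dots> = Re (iexp b * (CLINT \<omega>|M. iexp (X \<omega>)))"
    using int by (subst integral_Re[OF integrable_mult_right]) simp_all
  also have "(CLINT \<omega>|M. iexp (X \<omega>)) = of_real (exp (- v / 2))"
    using assms char_distr_eq[OF m, of 1] by (simp add: centered_normal_def)
  also have "Re (iexp b * of_real (exp (- v / 2))) = cos b * exp (- v / 2)"
    by (simp add: Re_exp)
  finally show ?thesis .
qed

lemma centered_normal_indep_sum:
  assumes ind: "indep_vars (\<lambda>_. borel) Z I"
    and Z: "\<And>i. i \<in> I \<Longrightarrow> distributed M lborel (Z i) std_normal_density"
  shows "centered_normal M (\<lambda>\<omega>. \<Sum>i\<in>I. c i * Z i \<omega>) (\<Sum>i\<in>I. (c i)\<^sup>2)"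
proof -
  have m: "Z i \<in> borel_measurable M" if "i \<in> I" for i
    using distributed_measurable[OF Z[OF that]] by simp
  have ind': "indep_vars (\<lambda>_. borel) (\<lambda>i \<omega>. c i * Z i \<omega>) I"
    by (rule indep_vars_compose2[OF ind]) auto
  have "char (distr M borel (\<lambda>\<omega>. \<Sum>i\<in>I. c i * Z i \<omega>)) u
      = of_real (exp (- ((\<Sum>i\<in>I. (c i)\<^sup>2) * u\<^sup>2) / 2))" for u
  proof -
    have "char (distr M borel (\<lambda>\<omega>. \<Sum>i\<in>I. c i * Z i \<omega>)) u
        = (\<Prod>i\<in>I. char (distr M borel (\<lambda>\<omega>. c i * Z i \<omega>)) u)"
      by (rule char_distr_sum[OF ind'])
    also have "\<dots> = (\<Prod>i\<in>I. of_real (exp (- ((c i)\<^sup>2 * u\<^sup>2) / 2)))"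
    proof (rule prod.cong)
      fix i assume i: "i \<in> I"
      note [measurable] = m[OF i]
      have "char (distr M borel (\<lambda>\<omega>. c i * Z i \<omega>)) u = char (distr M borel (Z i)) (u * c i)"
        by (simp add: char_distr_eq mult.assoc)
      also have "\<dots> = of_real (exp (- ((c i)\<^sup>2 * u\<^sup>2) / 2))"
        using centered_normal_density[OF _ Z[OF i]]
        by (simp add: centered_normal_def power_mult_distrib mult.commute)
      finally show "char (distr M borel (\<lambda>\<omega>. c i * Z i \<omega>)) u = of_real (exp (- ((c i)\<^sup>2 * u\<^sup>2) / 2))" .
    qed simp
    also have "\<dots> = of_real (exp (\<Sum>i\<in>I. - ((c i)\<^sup>2 * u\<^sup>2) / 2))"
      by (cases "finite I") (simp_all add: exp_sum)
    also have "(\<Sum>i\<in>I. - ((c i)\<^sup>2 * u\<^sup>2) / 2) = - ((\<Sum>i\<in>I. (c i)\<^sup>2) * u\<^sup>2) / 2"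
      by (simp add: sum_distrib_right sum_negf sum_divide_distrib)
    finally show ?thesis .
  qed
  moreover have "(\<lambda>\<omega>. \<Sum>i\<in>I. c i * Z i \<omega>) \<in> borel_measurable M"
    by (intro borel_measurable_sum borel_measurable_times borel_measurable_const m)
  ultimately show ?thesis
    by (simp add: centered_normal_def sum_nonneg)
qed

text \<open>Dominated convergence passes to the limit in the characteristic functions, which have
  modulus at most 1.\<close>

lemma centered_normal_AE_limit:
  assumes Y: "\<And>n. centered_normal M (Y n) (v n)" and m: "X \<in> borel_measurable M"
    and lim: "AE \<omega> in M. (\<lambda>n. Y n \<omega>) \<longlonglongrightarrow> X \<omega>" and v: "v \<longlonglongrightarrow> v'"
  shows "centered_normal M X v'"
proof -
  note [measurable] = m centered_normal_measurable[OF Y]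
  have "char (distr M borel X) u = of_real (exp (- (v' * u\<^sup>2) / 2))" for u
  proof (rule LIMSEQ_unique)
    have "(\<lambda>n. CLINT \<omega>|M. iexp (u * Y n \<omega>)) \<longlonglongrightarrow> (CLINT \<omega>|M. iexp (u * X \<omega>))"
    proof (rule integral_dominated_convergence[where w="\<lambda>_. 1"])
      show "AE \<omega> in M. (\<lambda>n. iexp (u * Y n \<omega>)) \<longlonglongrightarrow> iexp (u * X \<omega>)"
        using lim by eventually_elim (intro tendsto_intros)
    qed auto
    then show "(\<lambda>n. char (distr M borel (Y n)) u) \<longlonglongrightarrow> char (distr M borel X) u"
      by (simp add: char_distr_eq)
    have "(\<lambda>n. complex_of_real (exp (- (v n * u\<^sup>2) / 2))) \<longlonglongrightarrow> of_real (exp (- (v' * u\<^sup>2) / 2))"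
      by (intro tendsto_intros v) simp
    then show "(\<lambda>n. char (distr M borel (Y n)) u) \<longlonglongrightarrow> of_real (exp (- (v' * u\<^sup>2) / 2))"
      using Y by (simp add: centered_normal_def)
  qed
  moreover have "0 \<le> v'"
    using Y by (intro LIMSEQ_le_const[OF v]) (auto simp: centered_normal_def)
  ultimately show ?thesis
    using m by (simp add: centered_normal_def)
qed

end

subsection \<open>Weak convergence through trigonometric polynomials\<close>

text \<open>The phase \<open>b\<close> covers sines and constants as well, so inductions meet only
  one kind of generator, whose Gaussian expectation is known.\<close>

inductive trig_poly :: "'t set \<Rightarrow> (('t \<Rightarrow> real) \<Rightarrow> real) \<Rightarrow> bool" for J where
  wave: "trig_poly J (\<lambda>x. c * cos ((\<Sum>t\<in>J. u t * x t) + b))"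
| add: "trig_poly J p \<Longrightarrow> trig_poly J q \<Longrightarrow> trig_poly J (\<lambda>x. p x + q x)"

lemma trig_poly_const: "trig_poly J (\<lambda>_. c)"
  using trig_poly.wave[of J c "\<lambda>_. 0" 0] by simp

lemma trig_poly_sin:
  assumes "finite J" "t \<in> J"
  shows "trig_poly J (\<lambda>x. sin (a * x t))"
proof -
  have "(\<Sum>s\<in>J. (if s = t then a else 0) * x s) = a * x t" for x :: "'a \<Rightarrow> real"
    using assms by (simp add: if_distrib[of "\<lambda>c. c * _"] cong: if_cong)
  moreover have "cos (y + - pi / 2) = sin y" for y :: real
    using cos_sin_eq[of "y - pi / 2"] by (simp add: sin_diff)
  ultimately show ?thesis
    using trig_poly.wave[of J 1 "\<lambda>s. if s = t then a else 0" "- pi / 2"]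
    by (simp only: mult_1_left)
qed

text \<open>The product-to-sum formula for cosines; it makes the class an algebra, as the
  Stone-Weierstrass theorem requires.\<close>

lemma trig_poly_mult:
  assumes p: "trig_poly J p" and q: "trig_poly J q"
  shows "trig_poly J (\<lambda>x. p x * q x)"
  using p
proof induction
  case (wave c u b)
  show ?case
    using q
  proof induction
    case (wave d v a)
    have "c * cos ((\<Sum>t\<in>J. u t * x t) + b) * (d * cos ((\<Sum>t\<in>J. v t * x t) + a)) =
        c * d / 2 * cos ((\<Sum>t\<in>J. (u t - v t) * x t) + (b - a)) +
        c * d / 2 * cos ((\<Sum>t\<in>J. (u t + v t) * x t) + (b + a))" for x
    proof -
      have 1: "(\<Sum>t\<in>J. (u t - v t) * x t) + (b - a) =
          ((\<Sum>t\<in>J. u t * x t) + b) - ((\<Sum>t\<in>J. v t * x t) + a)"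
        by (simp add: left_diff_distrib sum_subtractf)
      have 2: "(\<Sum>t\<in>J. (u t + v t) * x t) + (b + a) =
          ((\<Sum>t\<in>J. u t * x t) + b) + ((\<Sum>t\<in>J. v t * x t) + a)"
        by (simp add: distrib_right sum.distrib)
      show ?thesis
        unfolding 1 2 cos_diff cos_add by (simp add: field_simps)
    qed
    then show ?case
      by (simp only:) (intro trig_poly.intros)
  qed (simp add: distrib_left trig_poly.add)
qed (simp add: distrib_right trig_poly.add)

lemma trig_poly_measurable:
  assumes "trig_poly J p"
  shows "p \<in> borel_measurable (\<Pi>\<^sub>M t\<in>J. borel)"
  using assms by induction auto

lemma trig_poly_bounded:
  assumes "trig_poly J p"
  shows "\<exists>C. \<forall>x. \<bar>p x\<bar> \<le> C"
  using assms
proof induction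
  case (wave c u b)
  then show ?case
    by (intro exI[of _ "\<bar>c\<bar>"]) (simp add: abs_mult mult_left_le)
next
  case (add p q)
  then obtain C D where "\<forall>x. \<bar>p x\<bar> \<le> C" "\<forall>x. \<bar>q x\<bar> \<le> D" by auto
  then have "\<bar>p x + q x\<bar> \<le> C + D" for x
    by (meson abs_triangle_ineq add_mono order_trans)
  then show ?case by blast
qed

text \<open>Extensional functions have the fixed value \<open>undefined\<close> outside
  \<open>J\<close>, so the cube is a product over the whole index type with singleton factors there,
  and Tychonoff's theorem applies.\<close>

lemma compact_PiE_Icc: "compact (PiE J (\<lambda>_. {a..b::real}))"
proof -
  have "PiE J (\<lambda>_. {a..b}) = PiE UNIV (\<lambda>t. if t \<in> J then {a..b} else {undefined})"
    by (auto simp: PiE_iff extensional_def split: if_splits)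
  moreover have "compactin (product_topology (\<lambda>_. euclidean) UNIV)
      (PiE UNIV (\<lambda>t. if t \<in> J then {a..b} else {undefined}))"
    unfolding compactin_PiE by auto
  ultimately show ?thesis
    by (simp add: euclidean_product_topology)
qed

text \<open>On the cube of side \<open>2 * L\<close> a point is recovered from the sines of its rescaled coordinates, so
  polynomial approximation in these sines gives trigonometric approximation on the cube which
  stays bounded outside of it.\<close>

lemma trig_poly_approx:
  fixes f :: "('t \<Rightarrow> real) \<Rightarrow> real"
  assumes J: "finite J"
    and f: "continuous_map (product_topology (\<lambda>_. euclideanreal) J) euclideanreal f"
    and C: "\<And>x. x \<in> J \<rightarrow>\<^sub>E UNIV \<Longrightarrow> \<bar>f x\<bar> \<le> C"
    and L: "0 < L" and e: "0 < e"
  obtains p where "trig_poly J p"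
    and "\<And>x. x \<in> J \<rightarrow>\<^sub>E {-L..L} \<Longrightarrow> \<bar>f x - p x\<bar> \<le> e"
    and "\<And>x. \<bar>p x\<bar> \<le> C + e"
proof -
  \<comment> \<open>Coordinates are relabelled by natural numbers, so that the compact cube lies in
    one function space over \<open>nat\<close>, whatever the type of the times.\<close>
  obtain h :: "'t \<Rightarrow> nat" where h: "inj_on h J"
    using finite_imp_inj_to_nat_seg[OF J] by blast
  define k where "k = the_inv_into J h"
  have hk: "k (h t) = t" if "t \<in> J" for t
    using h that by (simp add: k_def the_inv_into_f_f)
  define S :: "(nat \<Rightarrow> real) set" where "S = (h ` J \<rightarrow>\<^sub>E {-1..1})"
  \<comment> \<open>\<open>w\<close> maps every point into \<open>S\<close>, and \<open>v\<close>
    inverts it on the cube of half-side \<open>L\<close>, where the rescaled coordinates stay in the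
    range on which arcsin inverts sin.\<close>
  define w where "w = (\<lambda>x::'t \<Rightarrow> real. \<lambda>i\<in>h ` J. sin (pi / (2 * L) * x (k i)))"
  define v where "v = (\<lambda>y::nat \<Rightarrow> real. \<lambda>t\<in>J. 2 * L / pi * arcsin (y (h t)))"
  \<comment> \<open>The algebra for Stone-Weierstrass: continuous functions on \<open>S\<close>
    whose pullback along \<open>w\<close> is a trigonometric polynomial. It approximates
    \<open>f \<circ> v\<close>.\<close>
  define R where "R = {p. continuous_on S p \<and> trig_poly J (\<lambda>x. p (w x))}"
  have wS: "w x \<in> S" for x
    by (auto simp: w_def S_def)
  have coord: "continuous_on A (\<lambda>y::nat \<Rightarrow> real. y i)" for A i
    by (rule continuous_on_subset[OF continuous_on_product_coordinates]) simp
  interpret function_ring_on R S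
  proof
    show "compact S"
      unfolding S_def by (rule compact_PiE_Icc)
  next
    fix x y assume xy: "x \<in> S" "y \<in> S" "x \<noteq> y"
    then obtain i where i: "i \<in> h ` J" "x i \<noteq> y i"
      unfolding S_def by (metis PiE_ext)
    then have "k i \<in> J" using hk by auto
    then have "(\<lambda>y. y i) \<in> R"
      unfolding R_def using trig_poly_sin[OF J, of _ "pi / (2 * L)"] i(1) coord by (simp add: w_def)
    with i(2) show "\<exists>f\<in>R. f x \<noteq> f y"
      by (intro bexI[of _ "\<lambda>y. y i"])
  next
    fix f g assume "f \<in> R" "g \<in> R"
    then show "(\<lambda>x. f x + g x) \<in> R" "(\<lambda>x. f x * g x) \<in> R"
      by (simp_all add: R_def continuous_on_add continuous_on_mult trig_poly.add trig_poly_mult)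
  qed (simp_all add: R_def trig_poly_const)
  have vc: "continuous_map (top_of_set S) (product_topology (\<lambda>_. euclideanreal) J) v"
    unfolding continuous_map_componentwise
  proof (intro conjI ballI)
    show "v ` topspace (top_of_set S) \<subseteq> extensional J"
      by (auto simp: v_def)
    fix t assume "t \<in> J"
    then show "continuous_map (top_of_set S) euclideanreal (\<lambda>y. v y t)"
      unfolding v_def by (auto simp: S_def intro!: continuous_on_mult continuous_on_const continuous_on_arcsin continuous_on_divide coord)
  qed
  have "continuous_on S (f \<circ> v)"
    using continuous_map_compose[OF vc f] by simp
  from Stone_Weierstrass_basic[OF this e] obtain p
    where p: "p \<in> R" "\<And>y. y \<in> S \<Longrightarrow> \<bar>f (v y) - p y\<bar> < e"
    by auto
  show ?thesis
  proof (rule that)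
    show "trig_poly J (\<lambda>x. p (w x))"
      using p(1) by (simp add: R_def)
    show "\<bar>f x - p (w x)\<bar> \<le> e" if x: "x \<in> J \<rightarrow>\<^sub>E {-L..L}" for x
    proof -
      have "v (w x) = x"
      proof
        fix t
        show "v (w x) t = x t"
        proof (cases "t \<in> J")
          case True
          with x have "x t \<in> {-L..L}" by (rule PiE_mem)
          then have "\<bar>x t\<bar> \<le> L" by auto
          then have "\<bar>pi / (2 * L) * x t\<bar> \<le> pi / 2"
            using L by (simp add: abs_mult field_simps)
          then have "- (pi / 2) \<le> pi / (2 * L) * x t" "pi / (2 * L) * x t \<le> pi / 2"
            by linarith+
          then have "arcsin (sin (pi / (2 * L) * x t)) = pi / (2 * L) * x t"
            by (rule arcsin_sin)
          with True L show ?thesis by (simp add: v_def w_def hk)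
        qed (use x in \<open>auto simp: v_def\<close>)
      qed
      with p(2)[OF wS[of x]] show ?thesis by simp
    qed
    show "\<bar>p (w x)\<bar> \<le> C + e" for x
    proof -
      have "v (w x) \<in> J \<rightarrow>\<^sub>E UNIV"
        by (auto simp: v_def)
      from C[OF this] p(2)[OF wS[of x]] show ?thesis by linarith
    qed
  qed
qed

text \<open>A pointwise limit of measurable functions: the k-th trigonometric polynomial is within 1
  / (k + 1) on a cube of half-side k + 1, and every point is eventually in these cubes.\<close>

lemma continuous_map_product_borel_measurable:
  fixes f :: "('t \<Rightarrow> real) \<Rightarrow> real"
  assumes J: "finite J"
    and f: "continuous_map (product_topology (\<lambda>_. euclideanreal) J) euclideanreal f"
    and C: "\<And>x. x \<in> J \<rightarrow>\<^sub>E UNIV \<Longrightarrow> \<bar>f x\<bar> \<le> C"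
  shows "f \<in> borel_measurable (\<Pi>\<^sub>M t\<in>J. borel)"
proof -
  have "\<exists>p. trig_poly J p \<and> (\<forall>x\<in>J \<rightarrow>\<^sub>E {-real (Suc k)..real (Suc k)}. \<bar>f x - p x\<bar> \<le> inverse (real (Suc k)))" for k
    by (rule trig_poly_approx[OF J f C, of "real (Suc k)" "inverse (real (Suc k))"]) auto
  then obtain p where p: "\<And>k. trig_poly J (p k)"
    "\<And>k x. x \<in> J \<rightarrow>\<^sub>E {-real (Suc k)..real (Suc k)} \<Longrightarrow> \<bar>f x - p k x\<bar> \<le> inverse (real (Suc k))"
    by metis
  show ?thesis
  proof (rule borel_measurable_LIMSEQ_real)
    show "p k \<in> borel_measurable (\<Pi>\<^sub>M t\<in>J. borel)" for k
      using p(1) by (rule trig_poly_measurable)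
    fix x :: "'t \<Rightarrow> real" assume "x \<in> space (\<Pi>\<^sub>M t\<in>J. borel)"
    then have x: "x \<in> J \<rightarrow>\<^sub>E UNIV" by (simp add: space_PiM)
    obtain n where n: "(\<Sum>t\<in>J. \<bar>x t\<bar>) \<le> real n"
      using real_arch_simple by blast
    have "\<bar>p k x - f x\<bar> \<le> inverse (real (Suc k))" if "k \<ge> n" for k
    proof -
      have "\<bar>x t\<bar> \<le> real (Suc k)" if "t \<in> J" for t
        using member_le_sum[of t J "\<lambda>t. \<bar>x t\<bar>"] that J n \<open>k \<ge> n\<close> by simp
      then have "x t \<in> {-real (Suc k)..real (Suc k)}" if "t \<in> J" for t
        using that by (meson abs_le_D1 abs_le_D2 atLeastAtMost_iff minus_le_iff)
      then have "x \<in> J \<rightarrow>\<^sub>E {-real (Suc k)..real (Suc k)}"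
        using x by (auto simp only: PiE_iff)
      from p(2)[OF this] show ?thesis by (simp add: abs_minus_commute)
    qed
    then have "\<forall>\<^sub>F k in sequentially. norm (p k x - f x) \<le> inverse (real (Suc k))"
      by (auto simp: eventually_sequentially)
    then have "(\<lambda>k. p k x - f x) \<longlonglongrightarrow> 0"
      by (rule Lim_null_comparison) (rule LIMSEQ_inverse_real_of_nat)
    then show "(\<lambda>k. p k x) \<longlonglongrightarrow> f x"
      by (simp add: LIM_zero_iff)
  qed
qed

text \<open>Chebyshev's inequality in pointwise form: off the cube some coordinate exceeds
  \<open>L\<close>, so the sum of squares over \<open>L\<^sup>2\<close> is at least 1 and dominates
  the trivial bound \<open>2 * C + e\<close> once multiplied by it.\<close>

lemma trig_poly_expectation_error:
  fixes X :: "'t \<Rightarrow> 'a \<Rightarrow> real"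
  assumes M: "prob_space M" and J: "finite J"
    and f: "f \<in> borel_measurable (\<Pi>\<^sub>M t\<in>J. borel)" and p: "trig_poly J p"
    and C: "\<And>x. x \<in> J \<rightarrow>\<^sub>E UNIV \<Longrightarrow> \<bar>f x\<bar> \<le> C"
    and cube: "\<And>x. x \<in> J \<rightarrow>\<^sub>E {-L..L} \<Longrightarrow> \<bar>f x - p x\<bar> \<le> e"
    and bound: "\<And>x. \<bar>p x\<bar> \<le> C + e"
    and L: "0 < L" and e: "0 < e"
    and X: "\<And>t. t \<in> J \<Longrightarrow> X t \<in> borel_measurable M"
    and int: "\<And>t. t \<in> J \<Longrightarrow> integrable M (\<lambda>\<omega>. (X t \<omega>)\<^sup>2)"
    and V: "(\<Sum>t\<in>J. \<integral>\<omega>. (X t \<omega>)\<^sup>2 \<partial>M) \<le> V"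
  shows "\<bar>(\<integral>x. f x \<partial>fd_law M X J) - (\<integral>x. p x \<partial>fd_law M X J)\<bar> \<le> e + (2 * C + e) * V / L\<^sup>2"
proof -
  interpret prob_space M by fact
  define Z where "Z = (\<lambda>\<omega>. \<lambda>t\<in>J. X t \<omega>)"
  have Z [measurable]: "Z \<in> measurable M (\<Pi>\<^sub>M t\<in>J. borel)"
    unfolding Z_def by (intro measurable_restrict X)
  have ZE: "Z \<omega> \<in> J \<rightarrow>\<^sub>E UNIV" for \<omega> by (simp add: Z_def)
  note [measurable] = f trig_poly_measurable[OF p]
  have C0: "0 \<le> C" using C[OF ZE] by (meson abs_ge_zero order_trans)
  have fint: "integrable M (\<lambda>\<omega>. f (Z \<omega>))" and pint: "integrable M (\<lambda>\<omega>. p (Z \<omega>))"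
    by (rule integrable_const_bound[where B=C] integrable_const_bound[where B="C + e"];
        use C[OF ZE] bound in \<open>simp; measurable\<close>)+
  have pw: "\<bar>f (Z \<omega>) - p (Z \<omega>)\<bar> \<le> e + (2 * C + e) * (\<Sum>t\<in>J. (X t \<omega>)\<^sup>2) / L\<^sup>2" for \<omega>
  proof (cases "Z \<omega> \<in> J \<rightarrow>\<^sub>E {-L..L}")
    case True
    have "0 \<le> (2 * C + e) * (\<Sum>t\<in>J. (X t \<omega>)\<^sup>2) / L\<^sup>2"
      using C0 e by (intro divide_nonneg_nonneg mult_nonneg_nonneg sum_nonneg) auto
    with cube[OF True] show ?thesis by linarith
  next
    case False
    then obtain t where t: "t \<in> J" "\<not> \<bar>X t \<omega>\<bar> \<le> L"
      by (fastforce simp: Z_def abs_le_iff)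
    then have "L\<^sup>2 \<le> (X t \<omega>)\<^sup>2"
      using L by (intro abs_le_square_iff[THEN iffD1]) auto
    also have "\<dots> \<le> (\<Sum>t\<in>J. (X t \<omega>)\<^sup>2)"
      by (rule member_le_sum) (use t J in auto)
    finally have "1 \<le> (\<Sum>t\<in>J. (X t \<omega>)\<^sup>2) / L\<^sup>2"
      using L by simp
    then have "(2 * C + e) * 1 \<le> (2 * C + e) * ((\<Sum>t\<in>J. (X t \<omega>)\<^sup>2) / L\<^sup>2)"
      using C0 e by (intro mult_left_mono) auto
    moreover have "\<bar>f (Z \<omega>) - p (Z \<omega>)\<bar> \<le> 2 * C + e"
      using C[OF ZE[of \<omega>]] bound[of "Z \<omega>"] by linarith
    ultimately show ?thesis using e by simp
  qed
  have "\<bar>(\<integral>x. f x \<partial>fd_law M X J) - (\<integral>x. p x \<partial>fd_law M X J)\<bar> = \<bar>\<integral>\<omega>. f (Z \<omega>) - p (Z \<omega>) \<partial>M\<bar>"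
    unfolding fd_law_def Z_def[symmetric] using fint pint by (simp add: integral_distr)
  also have "\<dots> \<le> (\<integral>\<omega>. \<bar>f (Z \<omega>) - p (Z \<omega>)\<bar> \<partial>M)"
    by (rule integral_abs_bound)
  also have "\<dots> \<le> (\<integral>\<omega>. e + (2 * C + e) * (\<Sum>t\<in>J. (X t \<omega>)\<^sup>2) / L\<^sup>2 \<partial>M)"
    using fint pint int pw by (intro integral_mono) auto
  also have "\<dots> = e + (2 * C + e) * (\<Sum>t\<in>J. \<integral>\<omega>. (X t \<omega>)\<^sup>2 \<partial>M) / L\<^sup>2"
    using int by (simp add: prob_space)
  also have "\<dots> \<le> e + (2 * C + e) * V / L\<^sup>2"
    using V C0 e by (intro add_left_mono divide_right_mono mult_left_mono) auto
  finally show ?thesis .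
qed

lemma fd_law_trig_poly_tendsto:
  fixes X :: "nat \<Rightarrow> 't \<Rightarrow> 'a \<Rightarrow> real" and Y :: "'t \<Rightarrow> 'b \<Rightarrow> real"
  assumes M: "prob_space M" and N: "prob_space N"
    and X: "\<And>n t. t \<in> J \<Longrightarrow> X n t \<in> borel_measurable M"
    and Y: "\<And>t. t \<in> J \<Longrightarrow> Y t \<in> borel_measurable N"
    and lim: "\<And>u b. (\<lambda>n. \<integral>\<omega>. cos ((\<Sum>t\<in>J. u t * X n t \<omega>) + b) \<partial>M)
                \<longlonglongrightarrow> (\<integral>\<omega>. cos ((\<Sum>t\<in>J. u t * Y t \<omega>) + b) \<partial>N)"
    and p: "trig_poly J p"
  shows "(\<lambda>n. \<integral>x. p x \<partial>fd_law M (X n) J) \<longlonglongrightarrow> (\<integral>x. p x \<partial>fd_law N Y J)"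
proof -
  have mX [measurable]: "(\<lambda>\<omega>. \<lambda>t\<in>J. X n t \<omega>) \<in> measurable M (\<Pi>\<^sub>M t\<in>J. borel)" for n
    by (intro measurable_restrict X)
  have mY [measurable]: "(\<lambda>\<omega>. \<lambda>t\<in>J. Y t \<omega>) \<in> measurable N (\<Pi>\<^sub>M t\<in>J. borel)"
    by (intro measurable_restrict Y)
  have pM: "prob_space (fd_law M (X n) J)" for n
    unfolding fd_law_def by (rule prob_space.prob_space_distr[OF M mX])
  have pN: "prob_space (fd_law N Y J)"
    unfolding fd_law_def by (rule prob_space.prob_space_distr[OF N mY])
  have int: "integrable Q q" if q: "trig_poly J q" and Q: "prob_space Q"
    "sets Q = sets (\<Pi>\<^sub>M t\<in>J. borel)" for Q q
  proof -
    interpret prob_space Q by fact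
    obtain C where "\<And>x. \<bar>q x\<bar> \<le> C" using trig_poly_bounded[OF q] by auto
    then show ?thesis
      using trig_poly_measurable[OF q] Q(2)
      by (intro integrable_const_bound[where B=C]) (auto cong: measurable_cong_sets)
  qed
  have s: "sets (fd_law M (X n) J) = sets (\<Pi>\<^sub>M t\<in>J. borel)"
    "sets (fd_law N Y J) = sets (\<Pi>\<^sub>M t\<in>J. borel)" for n
    by (simp_all add: fd_law_def)
  show ?thesis
    using p
  proof induction
    case (wave c u b)
    have wm: "(\<lambda>x. cos ((\<Sum>t\<in>J. u t * x t) + b)) \<in> borel_measurable (\<Pi>\<^sub>M t\<in>J. borel)"
      by measurable
    have eq: "(\<Sum>t\<in>J. u t * (\<lambda>t\<in>J. g t) t) = (\<Sum>t\<in>J. u t * g t)" for g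
      by (rule sum.cong) auto
    have "(\<lambda>n. c * (\<integral>\<omega>. cos ((\<Sum>t\<in>J. u t * X n t \<omega>) + b) \<partial>M))
        \<longlonglongrightarrow> c * (\<integral>\<omega>. cos ((\<Sum>t\<in>J. u t * Y t \<omega>) + b) \<partial>N)"
      by (intro tendsto_mult tendsto_const lim)
    then show ?case
      unfolding fd_law_def by (simp add: integral_distr[OF mX wm] integral_distr[OF mY wm] eq)
  next
    case (add p q)
    then show ?case
      using int[OF _ pM s(1)] int[OF _ pN s(2)] by (simp add: tendsto_add)
  qed
qed

text \<open>The common bound \<open>V\<close> on second moments plays the part of tightness: one
  cube and one trigonometric polynomial serve all \<open>n\<close> and the limit.\<close>

lemma fd_law_weakly_converges:
  fixes X :: "nat \<Rightarrow> 't \<Rightarrow> 'a \<Rightarrow> real" and Y :: "'t \<Rightarrow> 'b \<Rightarrow> real"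
  assumes M: "prob_space M" and N: "prob_space N" and J: "finite J"
    and X: "\<And>n t. t \<in> J \<Longrightarrow> X n t \<in> borel_measurable M"
    and Y: "\<And>t. t \<in> J \<Longrightarrow> Y t \<in> borel_measurable N"
    and X2: "\<And>n t. t \<in> J \<Longrightarrow> integrable M (\<lambda>\<omega>. (X n t \<omega>)\<^sup>2)"
    and Y2: "\<And>t. t \<in> J \<Longrightarrow> integrable N (\<lambda>\<omega>. (Y t \<omega>)\<^sup>2)"
    and VX: "\<And>n. (\<Sum>t\<in>J. \<integral>\<omega>. (X n t \<omega>)\<^sup>2 \<partial>M) \<le> V"
    and VY: "(\<Sum>t\<in>J. \<integral>\<omega>. (Y t \<omega>)\<^sup>2 \<partial>N) \<le> V"
    and lim: "\<And>u b. (\<lambda>n. \<integral>\<omega>. cos ((\<Sum>t\<in>J. u t * X n t \<omega>) + b) \<partial>M)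
                \<longlonglongrightarrow> (\<integral>\<omega>. cos ((\<Sum>t\<in>J. u t * Y t \<omega>) + b) \<partial>N)"
  shows "weakly_converges (product_topology (\<lambda>_. euclideanreal) J)
           (\<lambda>n. fd_law M (X n) J) (fd_law N Y J)"
  unfolding weakly_converges_def
proof (intro allI impI, elim conjE)
  fix f assume f: "continuous_map (product_topology (\<lambda>_. euclideanreal) J) euclideanreal f"
    and "bounded (f ` topspace (product_topology (\<lambda>_. euclideanreal) J))"
  then obtain C where C0: "0 < C" and C: "\<And>x. x \<in> J \<rightarrow>\<^sub>E UNIV \<Longrightarrow> \<bar>f x\<bar> \<le> C"
    unfolding bounded_pos by auto
  have V0: "0 \<le> V" by (rule order_trans[OF _ VY]) (simp add: sum_nonneg)
  note fm = continuous_map_product_borel_measurable[OF J f C]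
  show "(\<lambda>n. \<integral>x. f x \<partial>fd_law M (X n) J) \<longlonglongrightarrow> (\<integral>x. f x \<partial>fd_law N Y J)"
  proof (rule LIMSEQ_I)
    fix r :: real assume r: "0 < r"
    \<comment> \<open>Two approximation errors of \<open>2 * e\<close> each and one convergence
      error below \<open>e\<close> stay below \<open>6 * e\<close>.\<close>
    define e where "e = r / 6"
    have e: "0 < e" using r by (simp add: e_def)
    \<comment> \<open>Chosen to make the tail term \<open>e * (V / (V + 1))\<close>, which is at
      most \<open>e\<close>; \<open>V + 1\<close> keeps \<open>L\<close> positive when
      \<open>V = 0\<close>.\<close>
    define L where "L = sqrt ((2 * C + e) * (V + 1) / e)"
    have L: "0 < L" and L2: "L\<^sup>2 = (2 * C + e) * (V + 1) / e"
      using e C0 V0 by (simp_all add: L_def)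
    have "2 * C + e > 0" using C0 e by simp
    then have "(2 * C + e) * V / L\<^sup>2 = e * (V / (V + 1))"
      unfolding L2 using V0 by simp
    also have "\<dots> \<le> e * 1"
      using e V0 by (intro mult_left_mono) auto
    finally have small: "e + (2 * C + e) * V / L\<^sup>2 \<le> 2 * e" by simp
    obtain p where p: "trig_poly J p"
      "\<And>x. x \<in> J \<rightarrow>\<^sub>E {-L..L} \<Longrightarrow> \<bar>f x - p x\<bar> \<le> e" "\<And>x. \<bar>p x\<bar> \<le> C + e"
      using trig_poly_approx[OF J f C L e] by blast
    have 1: "\<bar>(\<integral>x. f x \<partial>fd_law M (X n) J) - (\<integral>x. p x \<partial>fd_law M (X n) J)\<bar> \<le> 2 * e" for n
      by (rule order_trans[OF trig_poly_expectation_error[OF M J fm p(1) C p(2) p(3) L e X X2 VX] small])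
    have 2: "\<bar>(\<integral>x. f x \<partial>fd_law N Y J) - (\<integral>x. p x \<partial>fd_law N Y J)\<bar> \<le> 2 * e"
      by (rule order_trans[OF trig_poly_expectation_error[OF N J fm p(1) C p(2) p(3) L e Y Y2 VY] small])
    from LIMSEQ_D[OF fd_law_trig_poly_tendsto[OF M N X Y lim p(1)] e] obtain n0 where
      "\<And>n. n \<ge> n0 \<Longrightarrow> \<bar>(\<integral>x. p x \<partial>fd_law M (X n) J) - (\<integral>x. p x \<partial>fd_law N Y J)\<bar> < e"
      by auto
    moreover have "6 * e = r" by (simp add: e_def)
    ultimately have "\<bar>(\<integral>x. f x \<partial>fd_law M (X n) J) - (\<integral>x. f x \<partial>fd_law N Y J)\<bar> < r" if "n \<ge> n0" for n
      using 1[of n] 2 that r by (smt (verit))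
    then show "\<exists>no. \<forall>n\<ge>no.
        norm ((\<integral>x. f x \<partial>fd_law M (X n) J) - (\<integral>x. f x \<partial>fd_law N Y J)) < r"
      by auto
  qed
qed

subsection \<open>Gaussian processes with a given covariance\<close>

text \<open>Points may be repeated, so that adding a multiple of a point to a linear combination needs no
  case distinction.\<close>

definition psd_kernel :: "'t set \<Rightarrow> ('t \<Rightarrow> 't \<Rightarrow> real) \<Rightarrow> bool" where
  "psd_kernel T R \<longleftrightarrow> (\<forall>s\<in>T. \<forall>t\<in>T. R s t = R t s) \<and>
     (\<forall>(n::nat) t c. (\<forall>i<n. t i \<in> T) \<longrightarrow> 0 \<le> (\<Sum>i<n. \<Sum>j<n. c i * c j * R (t i) (t j)))"

lemma psd_kernel_sym: "psd_kernel T R \<Longrightarrow> s \<in> T \<Longrightarrow> t \<in> T \<Longrightarrow> R s t = R t s"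
  by (simp add: psd_kernel_def)

lemma psd_kernel_sum_nonneg:
  fixes n :: nat
  assumes "psd_kernel T R" "\<And>i. i < n \<Longrightarrow> t i \<in> T"
  shows "0 \<le> (\<Sum>i<n. \<Sum>j<n. c i * c j * R (t i) (t j))"
  using assms by (simp add: psd_kernel_def)

lemma psd_kernel_diag_nonneg:
  assumes "psd_kernel T R" "t \<in> T"
  shows "0 \<le> R t t"
  using psd_kernel_sum_nonneg[OF assms(1), of 1 "\<lambda>_. t" "\<lambda>_. 1"] assms(2) by simp

lemma psd_kernel_pair:
  assumes R: "psd_kernel T R" and st: "s \<in> T" "t \<in> T"
  shows "0 \<le> a\<^sup>2 * R s s + 2 * a * b * R s t + b\<^sup>2 * R t t"
proof -
  have "0 \<le> (\<Sum>i<2. \<Sum>j<2. (if i = 0 then a else b) * (if j = 0 then a else b) *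
      R (if i = (0::nat) then s else t) (if j = (0::nat) then s else t))"
    by (rule psd_kernel_sum_nonneg[OF R]) (use st in auto)
  then show ?thesis
    using psd_kernel_sym[OF R st]
    by (simp add: numeral_2_eq_2 lessThan_Suc power2_eq_square algebra_simps)
qed

lemma psd_kernel_abs_le:
  assumes R: "psd_kernel T R" and st: "s \<in> T" "t \<in> T"
  shows "2 * \<bar>R s t\<bar> \<le> R s s + R t t"
  using psd_kernel_pair[OF R st, of 1 1] psd_kernel_pair[OF R st, of 1 "-1"] by simp

lemma psd_kernel_zero_diag:
  assumes R: "psd_kernel T R" and st: "s \<in> T" "t \<in> T" and 0: "R t t = 0"
  shows "R s t = 0"
proof (rule ccontr)
  assume n: "R s t \<noteq> 0"
  \<comment> \<open>With zero variance at \<open>t\<close> the form is linear in the weight of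
    \<open>t\<close>; this weight drives its value to -1.\<close>
  have "0 \<le> R s s + 2 * (- (R s s + 1) / (2 * R s t)) * R s t"
    using psd_kernel_pair[OF R st, of 1 "- (R s s + 1) / (2 * R s t)"] 0 by simp
  also have "\<dots> = -1" using n by (simp add: field_simps)
  finally show False by simp
qed

text \<open>The new quadratic form is the minimum of the old one over the weight given to an extra
  point \<open>p\<close>. If \<open>R p p = 0\<close>, division by zero leaves the kernel
  unchanged.\<close>

lemma psd_kernel_schur_complement:
  assumes R: "psd_kernel T R" and p: "p \<in> T"
  shows "psd_kernel T (\<lambda>s t. R s t - R s p * R t p / R p p)"
proof (cases "R p p = 0")
  case True
  then show ?thesis using R by simp
next
  case False
  show ?thesis
    unfolding psd_kernel_def
  proof (intro conjI ballI allI impI)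
    show "R s t - R s p * R t p / R p p = R t s - R t p * R s p / R p p" if "s \<in> T" "t \<in> T" for s t
      using psd_kernel_sym[OF R that] by simp
    fix n :: nat and t c assume t: "\<forall>i<n. t i \<in> T"
    define A where "A = (\<Sum>i<n. c i * R (t i) p)"
    \<comment> \<open>The minimiser of the quadratic polynomial in the weight of \<open>p\<close>;
      its linear coefficient is \<open>2 * A\<close>.\<close>
    define x where "x = - A / R p p"
    define t' where "t' = t(n := p)"
    define c' where "c' = c(n := x)"
    have A': "(\<Sum>j<n. c j * R p (t j)) = A"
      unfolding A_def using t psd_kernel_sym[OF R _ p] by (intro sum.cong) auto
    have "0 \<le> (\<Sum>i<Suc n. \<Sum>j<Suc n. c' i * c' j * R (t' i) (t' j))"
      by (rule psd_kernel_sum_nonneg[OF R]) (use t p in \<open>auto simp: t'_def\<close>)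
    also have "\<dots> = (\<Sum>i<n. \<Sum>j<n. c i * c j * R (t i) (t j)) + x * A + x * A + x * x * R p p"
    proof -
      have "(\<Sum>i<Suc n. \<Sum>j<Suc n. c' i * c' j * R (t' i) (t' j)) =
          (\<Sum>i<n. (\<Sum>j<n. c i * c j * R (t i) (t j)) + x * (c i * R (t i) p))
          + ((\<Sum>j<n. x * (c j * R p (t j))) + x * x * R p p)"
        by (simp add: t'_def c'_def mult_ac)
      also have "\<dots> = (\<Sum>i<n. \<Sum>j<n. c i * c j * R (t i) (t j)) + x * A + x * A + x * x * R p p"
        unfolding sum.distrib sum_distrib_left[symmetric] A' by (simp add: A_def)
      finally show ?thesis .
    qed
    also have "\<dots> = (\<Sum>i<n. \<Sum>j<n. c i * c j * R (t i) (t j)) - A * A / R p p"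
      unfolding x_def using False by (simp add: field_simps)
    also have "A * A / R p p = (\<Sum>i<n. \<Sum>j<n. c i * c j * (R (t i) p * R (t j) p / R p p))"
      unfolding A_def sum_product sum_divide_distrib by (simp add: mult_ac)
    finally show "0 \<le> (\<Sum>i<n. \<Sum>j<n. c i * c j * (R (t i) (t j) - R (t i) p * R (t j) p / R p p))"
      by (simp add: right_diff_distrib sum_subtractf)
  qed
qed

section \<open>Pivoted Cholesky decomposition of a kernel\<close>

primrec residual :: "('t \<Rightarrow> 't \<Rightarrow> real) \<Rightarrow> (nat \<Rightarrow> 't) \<Rightarrow> nat \<Rightarrow> 't \<Rightarrow> 't \<Rightarrow> real" where
  "residual R q 0 = R"
| "residual R q (Suc k) = (\<lambda>s t. residual R q k s t -
     residual R q k s (q k) * residual R q k t (q k) / residual R q k (q k) (q k))"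

text \<open>Column \<open>k\<close> of the Cholesky factor. For a Gaussian process,
  \<open>residual R q k\<close> is the covariance conditional on the values at the first
  \<open>k\<close> points of \<open>q\<close>; a point already determined has pivot 0, and division
  by zero gives a zero column.\<close>

definition pivot_coeff :: "('t \<Rightarrow> 't \<Rightarrow> real) \<Rightarrow> (nat \<Rightarrow> 't) \<Rightarrow> nat \<Rightarrow> 't \<Rightarrow> real" where
  "pivot_coeff R q k t = residual R q k t (q k) / sqrt (residual R q k (q k) (q k))"

context
  fixes T :: "'t set" and R and q :: "nat \<Rightarrow> 't"
  assumes R: "psd_kernel T R" and q: "\<And>k. q k \<in> T"
begin

lemma psd_kernel_residual: "psd_kernel T (residual R q m)"
  by (induction m) (simp_all add: R q psd_kernel_schur_complement)

lemma residual_eq: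
  "R s t = (\<Sum>k<m. pivot_coeff R q k s * pivot_coeff R q k t) + residual R q m s t"
proof (induction m)
  case (Suc m)
  have "pivot_coeff R q m s * pivot_coeff R q m t =
      residual R q m s (q m) * residual R q m t (q m) / residual R q m (q m) (q m)"
    using psd_kernel_diag_nonneg[OF psd_kernel_residual q[of m], of m] by (simp add: pivot_coeff_def)
  with Suc show ?case by simp
qed simp

text \<open>Eliminating \<open>q m\<close> clears its row; for a zero pivot semidefiniteness has
  cleared it already. Later steps subtract products in which one factor belongs to a cleared
  row.\<close>

lemma residual_pivot: "i < m \<Longrightarrow> t \<in> T \<Longrightarrow> residual R q m t (q i) = 0"
proof (induction m arbitrary: t)
  case (Suc m)
  note psd = psd_kernel_residual[of m]
  show ?case
  proof (cases "i = m")
    case True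
    then show ?thesis
      using psd_kernel_zero_diag[OF psd Suc.prems(2) q[of m]]
      by (cases "residual R q m (q m) (q m) = 0") auto
  next
    case False
    with Suc have 0: "residual R q m s (q i) = 0" if "s \<in> T" for s using that by simp
    then have "residual R q m (q i) (q m) = 0"
      using psd_kernel_sym[OF psd q[of i] q[of m]] q by simp
    with 0 Suc.prems show ?thesis by simp
  qed
qed simp

text \<open>Conditioning does not increase the variance of an increment: the loss is a sum of
  squares of coefficient differences.\<close>

lemma residual_increment_le:
  assumes "s \<in> T" "t \<in> T"
  shows "residual R q m s s - 2 * residual R q m s t + residual R q m t t \<le> R s s - 2 * R s t + R t t"
proof -
  have "R s s - 2 * R s t + R t t
      - (residual R q m s s - 2 * residual R q m s t + residual R q m t t)
      = (\<Sum>k<m. (pivot_coeff R q k s - pivot_coeff R q k t)\<^sup>2)"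
    unfolding residual_eq[of s s m] residual_eq[of s t m] residual_eq[of t t m]
    by (simp add: power2_diff sum.distrib sum_subtractf sum_distrib_left mult.assoc power2_eq_square[symmetric])
  then show ?thesis
    using sum_nonneg[of "{..<m}" "\<lambda>k. (pivot_coeff R q k s - pivot_coeff R q k t)\<^sup>2"] by simp
qed

context
  assumes dense: "\<forall>t\<in>T. \<forall>e>0. \<exists>k. R t t - 2 * R t (q k) + R (q k) (q k) < e"
begin

text \<open>Once \<open>q k\<close> has been eliminated, the residual variance at \<open>t\<close>
  equals that of the increment from \<open>q k\<close> to \<open>t\<close>, which the density of
  \<open>q\<close> makes small.\<close>

lemma residual_diag_tendsto:
  assumes t: "t \<in> T"
  shows "(\<lambda>m. residual R q m t t) \<longlonglongrightarrow> 0"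
proof (rule LIMSEQ_I)
  fix e :: real assume "0 < e"
  then obtain k where k: "R t t - 2 * R t (q k) + R (q k) (q k) < e" using dense t by blast
  have "norm (residual R q m t t - 0) < e" if "m \<ge> Suc k" for m
    using residual_increment_le[OF t q[of k], of m] k residual_pivot[of k m] t q that
      psd_kernel_diag_nonneg[OF psd_kernel_residual t, of m] by simp
  then show "\<exists>m0. \<forall>m\<ge>m0. norm (residual R q m t t - 0) < e" by blast
qed

lemma residual_tendsto:
  assumes "s \<in> T" "t \<in> T"
  shows "(\<lambda>m. residual R q m s t) \<longlonglongrightarrow> 0"
proof (rule Lim_null_comparison)
  show "\<forall>\<^sub>F m in sequentially. norm (residual R q m s t) \<le> (residual R q m s s + residual R q m t t) / 2"
    using psd_kernel_abs_le[OF psd_kernel_residual assms] by (intro always_eventually) (simp add: mult.commute)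
  show "(\<lambda>m. (residual R q m s s + residual R q m t t) / 2) \<longlonglongrightarrow> 0"
    using tendsto_divide[OF tendsto_add[OF residual_diag_tendsto residual_diag_tendsto] tendsto_const, of s t 2] assms
    by simp
qed

end

end

text \<open>The index type \<open>real\<close> gives the space the type asked for in the theorem;
  the independent normals are read off at \<open>\<omega> (real k)\<close>.\<close>

definition white_noise :: "(real \<Rightarrow> real) measure" where
  "white_noise = (\<Pi>\<^sub>M i\<in>UNIV. std_normal_distribution)"

lemma prob_space_white_noise: "prob_space white_noise"
proof -
  interpret real_distribution std_normal_distribution by (rule real_dist_normal_dist)
  show ?thesis unfolding white_noise_def by (intro prob_space_PiM) unfold_locales
qed

lemma white_noise_distributed:
  "distributed white_noise lborel (\<lambda>\<omega>. \<omega> x) std_normal_density"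
proof -
  interpret real_distribution std_normal_distribution by (rule real_dist_normal_dist)
  have p: "prob_space std_normal_distribution" by unfold_locales
  have "distr white_noise lborel (\<lambda>\<omega>. \<omega> x) = distr white_noise std_normal_distribution (\<lambda>\<omega>. \<omega> x)"
    by (intro distr_cong) auto
  also have "\<dots> = std_normal_distribution"
    unfolding white_noise_def by (rule distr_PiM_component) (auto intro: p)
  finally have "distr white_noise lborel (\<lambda>\<omega>. \<omega> x) = std_normal_distribution" .
  moreover have "(\<lambda>\<omega>. \<omega> x) \<in> measurable white_noise lborel"
    unfolding white_noise_def
    \<comment> \<open>The normal law is a density over \<open>lborel\<close> and shares its space
      and sets; unfolding them changes the target of the projection accordingly.\<close>
    by (rule measurable_component_singleton[of x UNIV "\<lambda>_. std_normal_distribution",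
          unfolded measurable_def sets_density space_density, folded measurable_def]) simp
  ultimately show ?thesis
    by (simp add: distributed_def)
qed

text \<open>The joint law of coordinates picked by an injective map is again a product law, which
  characterises independence.\<close>

lemma white_noise_indep:
  "prob_space.indep_vars white_noise (\<lambda>_. borel) (\<lambda>k \<omega>. \<omega> (real k)) UNIV"
proof -
  interpret W: prob_space white_noise by (rule prob_space_white_noise)
  interpret real_distribution std_normal_distribution by (rule real_dist_normal_dist)
  have p: "prob_space std_normal_distribution" by unfold_locales
  have m: "(\<lambda>\<omega>. \<omega> x) \<in> borel_measurable white_noise" for x
    using distributed_measurable[OF white_noise_distributed[of x]] by simp
  have d: "distr white_noise borel (\<lambda>\<omega>. \<omega> x) = std_normal_distribution" for x
    using distributed_distr_eq_density[OF white_noise_distributed[of x]] by (simp cong: distr_cong)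
  have "distr white_noise (\<Pi>\<^sub>M k\<in>UNIV. borel) (\<lambda>\<omega>. \<lambda>k\<in>UNIV. \<omega> (real k)) =
      distr white_noise (\<Pi>\<^sub>M k\<in>UNIV. std_normal_distribution) (\<lambda>\<omega>. \<lambda>k\<in>UNIV. \<omega> (real k))"
    by (intro distr_cong sets_PiM_cong) auto
  also have "\<dots> = (\<Pi>\<^sub>M k\<in>UNIV. std_normal_distribution)"
    unfolding white_noise_def
    by (rule distr_PiM_reindex[of UNIV "\<lambda>_. std_normal_distribution" real UNIV])
      (auto intro: p inj_of_nat)
  finally show ?thesis
    by (subst W.indep_vars_iff_distr_eq_PiM') (simp_all add: m d)
qed

text \<open>From the inequality of arithmetic and geometric means in the form |x| <= (d + x^2 / d) /
  2; it turns small variances into the L1 Cauchy property.\<close>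

lemma (in prob_space) centered_normal_expectation_abs_le:
  assumes X: "centered_normal M X v" and d: "0 < d" and v: "v \<le> d\<^sup>2"
  shows "expectation (\<lambda>\<omega>. \<bar>X \<omega>\<bar>) \<le> d"
proof -
  note sq = centered_normal_square_integrable[OF X]
  have [measurable]: "X \<in> borel_measurable M" using X by (rule centered_normal_measurable)
  have b: "\<bar>X \<omega>\<bar> \<le> (d + (X \<omega>)\<^sup>2 / d) / 2" for \<omega>
  proof -
    have "0 \<le> (\<bar>X \<omega>\<bar> - d)\<^sup>2" by simp
    then show ?thesis using d by (simp add: power2_diff field_simps power2_eq_square)
  qed
  have int: "integrable M (\<lambda>\<omega>. (d + (X \<omega>)\<^sup>2 / d) / 2)" using sq by simp
  have i: "integrable M X"
    by (rule centered_normal_integrable[OF X])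
  have "expectation (\<lambda>\<omega>. \<bar>X \<omega>\<bar>) \<le> expectation (\<lambda>\<omega>. (d + (X \<omega>)\<^sup>2 / d) / 2)"
    using i int b by (intro integral_mono) auto
  also have "\<dots> = (d + v / d) / 2"
    using sq centered_normal_imp_normal_rv(3)[OF X] by (simp add: prob_space)
  also have "\<dots> \<le> d"
    using d v by (simp add: field_simps power2_eq_square)
  finally show "expectation (\<lambda>\<omega>. \<bar>X \<omega>\<bar>) \<le> d" .
qed

text \<open>Pivoted Cholesky decomposition along the dense sequence \<open>q\<close> expresses the kernel as
  \<open>R s t = (\<Sum>k. a k s * a k t)\<close>; the process is the sum of \<open>a k t\<close> times the \<open>k\<close>-th white noise
  variable.\<close>

theorem gaussian_process_exists:
  fixes q :: "nat \<Rightarrow> 't"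
  assumes R: "psd_kernel T R" and q: "\<And>k. q k \<in> T"
    and dense: "\<forall>t\<in>T. \<forall>e>0. \<exists>k. R t t - 2 * R t (q k) + R (q k) (q k) < e"
  obtains B where "\<And>J c. finite J \<Longrightarrow> J \<subseteq> T \<Longrightarrow>
    centered_normal white_noise (\<lambda>\<omega>. \<Sum>t\<in>J. c t * B t \<omega>) (\<Sum>s\<in>J. \<Sum>t\<in>J. c s * c t * R s t)"
proof -
  interpret W: prob_space white_noise by (rule prob_space_white_noise)
  note res = psd_kernel_residual[of T R q, OF R q] residual_eq[of T R q, OF R q]
  have res0: "(\<lambda>m. residual R q m s t) \<longlonglongrightarrow> 0" if "s \<in> T" "t \<in> T" for s t
    by (rule residual_tendsto[OF R q dense that])
  define a where "a = pivot_coeff R q"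
  define S where "S m t \<omega> = (\<Sum>k<m. a k t * \<omega> (real k))" for m t and \<omega> :: "real \<Rightarrow> real"
  have cn: "centered_normal white_noise (\<lambda>\<omega>. \<Sum>k<n. c k * \<omega> (real k)) (\<Sum>k<n. (c k)\<^sup>2)" for n :: nat and c
    by (rule W.centered_normal_indep_sum)
      (auto intro: white_noise_distributed W.indep_vars_subset[OF white_noise_indep])
  have pad: "(\<Sum>k<m. f k) = (\<Sum>k<n. if k < m then f k else 0)" if "m \<le> n" for f :: "nat \<Rightarrow> real" and m n
  proof -
    have "{..<n} \<inter> {k. k < m} = {..<m}" using that by auto
    then show ?thesis by (simp add: sum.If_cases)
  qed
  \<comment> \<open>Each time has its own truncation level, because the subsequences chosen below
    depend on the time. Two truncations share their first \<open>min (m s) (m t)\<close> terms,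
    hence the residual at that level.\<close>
  have comb: "centered_normal white_noise (\<lambda>\<omega>. \<Sum>t\<in>J. c t * S (m t) t \<omega>)
      (\<Sum>s\<in>J. \<Sum>t\<in>J. c s * c t * (R s t - residual R q (min (m s) (m t)) s t))"
    if J: "finite J" for J c m
  proof -
    define n where "n = (\<Sum>t\<in>J. m t)"
    have n: "m t \<le> n" if "t \<in> J" for t
      unfolding n_def using that J by (intro member_le_sum) auto
    define a' where "a' k t = (if k < m t then a k t else 0)" for k t
    have "(\<Sum>k<n. (\<Sum>t\<in>J. c t * a' k t) * \<omega> (real k)) = (\<Sum>t\<in>J. c t * S (m t) t \<omega>)" for \<omega>
    proof -
      have "(\<Sum>k<n. (\<Sum>t\<in>J. c t * a' k t) * \<omega> (real k)) = (\<Sum>t\<in>J. c t * (\<Sum>k<n. a' k t * \<omega> (real k)))"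
        unfolding sum_distrib_right sum_distrib_left by (subst sum.swap) (simp add: mult.assoc)
      also have "\<dots> = (\<Sum>t\<in>J. c t * S (m t) t \<omega>)"
      proof (rule sum.cong)
        fix t assume "t \<in> J"
        then show "c t * (\<Sum>k<n. a' k t * \<omega> (real k)) = c t * S (m t) t \<omega>"
          unfolding S_def pad[OF n[OF \<open>t \<in> J\<close>]] a'_def
          by (intro arg_cong[where f="(*) (c t)"] sum.cong) auto
      qed simp
      finally show ?thesis .
    qed
    moreover have "(\<Sum>k<n. (\<Sum>t\<in>J. c t * a' k t)\<^sup>2) =
      (\<Sum>s\<in>J. \<Sum>t\<in>J. c s * c t * (R s t - residual R q (min (m s) (m t)) s t))"
    proof -
      have "(\<Sum>k<n. (\<Sum>t\<in>J. c t * a' k t)\<^sup>2) = (\<Sum>k<n. \<Sum>s\<in>J. \<Sum>t\<in>J. c s * c t * (a' k s * a' k t))"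
        unfolding power2_eq_square sum_product by (simp add: mult_ac)
      also have "\<dots> = (\<Sum>s\<in>J. \<Sum>k<n. \<Sum>t\<in>J. c s * c t * (a' k s * a' k t))"
        by (rule sum.swap)
      also have "\<dots> = (\<Sum>s\<in>J. \<Sum>t\<in>J. c s * c t * (\<Sum>k<n. a' k s * a' k t))"
        unfolding sum_distrib_left by (intro sum.cong refl sum.swap)
      also have "\<dots> = (\<Sum>s\<in>J. \<Sum>t\<in>J. c s * c t * (R s t - residual R q (min (m s) (m t)) s t))"
      proof (intro sum.cong refl)
        fix s t assume st: "s \<in> J" "t \<in> J"
        have "(\<Sum>k<n. a' k s * a' k t) = (\<Sum>k<min (m s) (m t). a k s * a k t)"
          using n[OF st(1)] by (subst pad[of _ n]) (auto simp: a'_def intro!: sum.cong)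
        then show "c s * c t * (\<Sum>k<n. a' k s * a' k t) =
            c s * c t * (R s t - residual R q (min (m s) (m t)) s t)"
          using res(2)[of s t "min (m s) (m t)"] by (simp add: a_def)
      qed
      finally show ?thesis .
    qed
    ultimately show ?thesis
      using cn[of "\<lambda>k. \<Sum>t\<in>J. c t * a' k t" n] by simp
  qed
  have diff: "centered_normal white_noise (\<lambda>\<omega>. S i t \<omega> - S j t \<omega>)
      (\<Sum>k<i. (if k < j then 0 else a k t)\<^sup>2)" if "j \<le> i" for i j t
  proof -
    have "S i t \<omega> - S j t \<omega> = (\<Sum>k<i. (if k < j then 0 else a k t) * \<omega> (real k))" for \<omega>
      unfolding S_def pad[OF that] sum_subtractf[symmetric] by (intro sum.cong) auto
    then show ?thesis using cn[of "\<lambda>k. if k < j then 0 else a k t" i] by simp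
  qed
  have diff_var: "(\<Sum>k<i. (if k < j then 0 else a k t)\<^sup>2) \<le> residual R q j t t"
    if "j \<le> i" "t \<in> T" for i j t
  proof -
    have "(\<Sum>k<i. (if k < j then 0 else a k t)\<^sup>2) = (\<Sum>k<i. a k t * a k t) - (\<Sum>k<j. a k t * a k t)"
      unfolding pad[OF that(1)] sum_subtractf[symmetric] by (intro sum.cong) (auto simp: power2_eq_square)
    also have "\<dots> = residual R q j t t - residual R q i t t"
      using res(2)[of t t i] res(2)[of t t j] by (simp add: a_def)
    finally show ?thesis
      using psd_kernel_diag_nonneg[OF res(1) that(2), of i] by simp
  qed
  have Sint: "integrable white_noise (S m t)" for m t
  proof -
    have "centered_normal white_noise (S m t) (\<Sum>k<m. (a k t)\<^sup>2)"
      using cn[of "\<lambda>k. a k t" m] by (simp add: S_def[abs_def])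
    then show ?thesis by (rule W.centered_normal_integrable)
  qed
  \<comment> \<open>The partial sums are Cauchy in L1, since the variance of a tail is at most a
    residual; this yields an almost surely convergent subsequence for each \<open>t\<close>.\<close>
  have "\<exists>r. strict_mono r \<and> (AE \<omega> in white_noise. Cauchy (\<lambda>m. S (r m) t \<omega>))" if t: "t \<in> T" for t
  proof (rule cauchy_L1_AE_cauchy_subseq[of white_noise "\<lambda>m. S m t"])
    show "integrable white_noise (S m t)" for m by (rule Sint)
    fix e :: real assume e: "0 < e"
    have "\<forall>\<^sub>F m in sequentially. residual R q m t t < (e / 2)\<^sup>2"
      using order_tendstoD(2)[OF res0[OF t t], of "(e / 2)\<^sup>2"] e by simp
    then obtain m0 where m0: "\<And>m. m \<ge> m0 \<Longrightarrow> residual R q m t t < (e / 2)\<^sup>2"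
      by (auto simp: eventually_sequentially)
    have *: "(LINT \<omega>|white_noise. \<bar>S i t \<omega> - S j t \<omega>\<bar>) < e" if "m0 \<le> j" "j \<le> i" for i j
    proof -
      have "(LINT \<omega>|white_noise. \<bar>S i t \<omega> - S j t \<omega>\<bar>) \<le> e / 2"
        using diff_var[OF that(2) t] m0[OF that(1)] e
        by (intro W.centered_normal_expectation_abs_le[OF diff[OF that(2)]]) auto
      with e show ?thesis by simp
    qed
    have "(LINT \<omega>|white_noise. norm (S i t \<omega> - S j t \<omega>)) < e" if "m0 \<le> i" "m0 \<le> j" for i j
      using *[of i j] *[of j i] that by (cases "i \<le> j") (auto simp: abs_minus_commute)
    then show "\<exists>N. \<forall>i\<ge>N. \<forall>j\<ge>N. (LINT \<omega>|white_noise. norm (S i t \<omega> - S j t \<omega>)) < e"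
      by blast
  qed blast
  then obtain r where r: "\<And>t. t \<in> T \<Longrightarrow> strict_mono (r t)"
    "\<And>t. t \<in> T \<Longrightarrow> AE \<omega> in white_noise. Cauchy (\<lambda>m. S (r t m) t \<omega>)"
    by metis
  define B where "B t \<omega> = lim (\<lambda>m. S (r t m) t \<omega>)" for t \<omega>
  have Sm [measurable]: "S m t \<in> borel_measurable white_noise" for m t
    using Sint by (rule borel_measurable_integrable)
  have Bm [measurable]: "B t \<in> borel_measurable white_noise" for t
    unfolding B_def[abs_def] by measurable
  have Blim: "AE \<omega> in white_noise. (\<lambda>m. S (r t m) t \<omega>) \<longlonglongrightarrow> B t \<omega>" if "t \<in> T" for t
    using r(2)[OF that] unfolding B_def
    by eventually_elim (simp add: Cauchy_convergent convergent_LIMSEQ_iff[symmetric])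
  show ?thesis
  proof (rule that)
    fix J c assume J: "finite J" "J \<subseteq> T"
    show "centered_normal white_noise (\<lambda>\<omega>. \<Sum>t\<in>J. c t * B t \<omega>) (\<Sum>s\<in>J. \<Sum>t\<in>J. c s * c t * R s t)"
    proof (rule W.centered_normal_AE_limit)
      show "centered_normal white_noise (\<lambda>\<omega>. \<Sum>t\<in>J. c t * S (r t m) t \<omega>)
        (\<Sum>s\<in>J. \<Sum>t\<in>J. c s * c t * (R s t - residual R q (min (r s m) (r t m)) s t))" for m
        by (rule comb[OF J(1)])
      have "AE \<omega> in white_noise. \<forall>t\<in>J. (\<lambda>m. S (r t m) t \<omega>) \<longlonglongrightarrow> B t \<omega>"
        using J Blim by (intro AE_finite_allI) auto
      then show "AE \<omega> in white_noise. (\<lambda>m. \<Sum>t\<in>J. c t * S (r t m) t \<omega>) \<longlonglongrightarrow> (\<Sum>t\<in>J. c t * B t \<omega>)"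
        by eventually_elim (intro tendsto_intros, auto)
      have "(\<lambda>m. residual R q (min (r s m) (r t m)) s t) \<longlonglongrightarrow> 0" if "s \<in> J" "t \<in> J" for s t
      proof -
        have st: "s \<in> T" "t \<in> T" using J that by auto
        \<comment> \<open>A strictly increasing index sequence dominates the identity, so the
          smaller of the two levels still tends to infinity.\<close>
        have "m \<le> min (r s m) (r t m)" for m
          using seq_suble[OF r(1)[OF st(1)], of m] seq_suble[OF r(1)[OF st(2)], of m] by simp
        then have "filterlim (\<lambda>m. min (r s m) (r t m)) at_top sequentially"
          by (intro filterlim_at_top_mono[OF filterlim_ident]) auto
        from filterlim_compose[OF res0[OF st] this] show ?thesis .
      qed
      then have "(\<lambda>m. \<Sum>s\<in>J. \<Sum>t\<in>J. c s * c t * (R s t - residual R q (min (r s m) (r t m)) s t))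
          \<longlonglongrightarrow> (\<Sum>s\<in>J. \<Sum>t\<in>J. c s * c t * (R s t - 0))"
        by (intro tendsto_intros) auto
      then show "(\<lambda>m. \<Sum>s\<in>J. \<Sum>t\<in>J. c s * c t * (R s t - residual R q (min (r s m) (r t m)) s t))
          \<longlonglongrightarrow> (\<Sum>s\<in>J. \<Sum>t\<in>J. c s * c t * R s t)"
        by simp
    qed measurable
  qed
qed

subsection \<open>Partial sums of the Gaussian sequence\<close>

lemma integrable_mult_of_squares:
  fixes f g :: "'a \<Rightarrow> real"
  assumes [measurable]: "f \<in> borel_measurable M" "g \<in> borel_measurable M"
    and "integrable M (\<lambda>\<omega>. (f \<omega>)\<^sup>2)" "integrable M (\<lambda>\<omega>. (g \<omega>)\<^sup>2)"
  shows "integrable M (\<lambda>\<omega>. f \<omega> * g \<omega>)"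
proof (rule Bochner_Integration.integrable_bound)
  show "integrable M (\<lambda>\<omega>. (f \<omega>)\<^sup>2 + (g \<omega>)\<^sup>2)" using assms by simp
  show "AE \<omega> in M. norm (f \<omega> * g \<omega>) \<le> norm ((f \<omega>)\<^sup>2 + (g \<omega>)\<^sup>2)"
  proof (rule AE_I2)
    fix \<omega>
    have "0 \<le> (\<bar>f \<omega>\<bar> - \<bar>g \<omega>\<bar>)\<^sup>2" by simp
    then have "2 * (\<bar>f \<omega>\<bar> * \<bar>g \<omega>\<bar>) \<le> (f \<omega>)\<^sup>2 + (g \<omega>)\<^sup>2"
      by (simp add: power2_diff)
    moreover have "0 \<le> \<bar>f \<omega>\<bar> * \<bar>g \<omega>\<bar>" by simp
    ultimately have "\<bar>f \<omega>\<bar> * \<bar>g \<omega>\<bar> \<le> (f \<omega>)\<^sup>2 + (g \<omega>)\<^sup>2" by linarith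
    then show "norm (f \<omega> * g \<omega>) \<le> norm ((f \<omega>)\<^sup>2 + (g \<omega>)\<^sup>2)"
      by (simp add: abs_mult)
  qed
qed measurable

lemma integral_square_sum:
  fixes X :: "'i \<Rightarrow> 'a \<Rightarrow> real"
  assumes "\<And>i j. i \<in> I \<Longrightarrow> j \<in> I \<Longrightarrow> integrable M (\<lambda>\<omega>. X i \<omega> * X j \<omega>)"
  shows "(\<integral>\<omega>. (\<Sum>i\<in>I. c i * X i \<omega>)\<^sup>2 \<partial>M) = (\<Sum>i\<in>I. \<Sum>j\<in>I. c i * c j * (\<integral>\<omega>. X i \<omega> * X j \<omega> \<partial>M))"
proof -
  have "(\<integral>\<omega>. (\<Sum>i\<in>I. c i * X i \<omega>)\<^sup>2 \<partial>M) = (\<integral>\<omega>. (\<Sum>i\<in>I. \<Sum>j\<in>I. c i * c j * (X i \<omega> * X j \<omega>)) \<partial>M)"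
    by (intro Bochner_Integration.integral_cong) (simp_all add: power2_eq_square sum_product mult_ac)
  also have "\<dots> = (\<Sum>i\<in>I. \<Sum>j\<in>I. c i * c j * (\<integral>\<omega>. X i \<omega> * X j \<omega> \<partial>M))"
    using assms by (simp add: Bochner_Integration.integral_sum)
  finally show ?thesis .
qed

text \<open>Polarization from the variances of \<open>B s\<close>, \<open>B t\<close> and their sum;
  \<open>s = t\<close> is separate because the set \<open>{s, t}\<close> collapses.\<close>

lemma (in prob_space) centered_normal_covariance:
  assumes B: "\<And>J c. finite J \<Longrightarrow> J \<subseteq> T \<Longrightarrow>
      centered_normal M (\<lambda>\<omega>. \<Sum>t\<in>J. c t * B t \<omega>) (\<Sum>s\<in>J. \<Sum>t\<in>J. c s * c t * R s t)"
    and sym: "R s t = R t s" and st: "s \<in> T" "t \<in> T"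
  shows "expectation (\<lambda>\<omega>. B s \<omega> * B t \<omega>) = R s t"
proof -
  have one: "centered_normal M (B u) (R u u)" if "u \<in> T" for u
    using B[of "{u}" "\<lambda>_. 1"] that by simp
  show ?thesis
  proof (cases "s = t")
    case True
    then show ?thesis
      using centered_normal_imp_normal_rv(3)[OF one[OF st(1)]] by (simp add: power2_eq_square)
  next
    case False
    have sum: "centered_normal M (\<lambda>\<omega>. B s \<omega> + B t \<omega>) (R s s + 2 * R s t + R t t)"
      using B[of "{s, t}" "\<lambda>_. 1"] st False sym by (simp add: algebra_simps)
    note c = sum one[OF st(1)] one[OF st(2)]
    have "expectation (\<lambda>\<omega>. B s \<omega> * B t \<omega>) =
        expectation (\<lambda>\<omega>. ((B s \<omega> + B t \<omega>)\<^sup>2 - (B s \<omega>)\<^sup>2 - (B t \<omega>)\<^sup>2) / 2)"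
      by (intro Bochner_Integration.integral_cong) (simp_all add: power2_eq_square algebra_simps)
    also have "\<dots> = ((R s s + 2 * R s t + R t t) - R s s - R t t) / 2"
      using c[THEN centered_normal_imp_normal_rv(3)] c[THEN centered_normal_square_integrable] by simp
    finally show ?thesis by simp
  qed
qed

theorem proposition6p1:
  fixes H K :: real and M :: "'a measure" and \<xi> :: "nat \<Rightarrow> 'a \<Rightarrow> real"
  assumes "0 < H" "H < 1" "0 < K" "K < 1" "2 * H * K > 1"
    and "jointly_gaussian M {1..} \<xi>"
    and "\<And>j. j \<ge> 1 \<Longrightarrow> distributed M lborel (\<xi> j) std_normal_density"
    and "\<And>i j. i \<ge> 1 \<Longrightarrow> j \<ge> 1 \<Longrightarrow> i \<noteq> j \<Longrightarrow>
           (\<integral>\<omega>. \<xi> i \<omega> * \<xi> j \<omega> \<partial>M) = bfbm_g H K (real i) (real j)"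
  shows "\<exists>(N :: (real \<Rightarrow> real) measure) B.
           bifractional_brownian_motion H K N B \<and>
           fdd_converges {0..} M
             (\<lambda>n t \<omega>. real n powr (- (H * K)) * (\<Sum>j = 1..nat \<lfloor>real n * t\<rfloor>. \<xi> j \<omega>))
             N B"
proof -
  interpret M: prob_space M using assms(6) by (simp add: jointly_gaussian_def)
  interpret W: prob_space white_noise by (rule prob_space_white_noise)
  define p where "p = 2 * H"
  define a where "a = p * K"
  have HK: "H * K < 1" using assms(1-4) by (smt (verit) mult_less_cancel_left2)
  have a: "1 < a" "a < 2" using assms(5) HK by (simp_all add: a_def p_def)
  \<comment> \<open>From \<open>p * K > 1\<close> and \<open>K < 1\<close>; it makes
    \<open>x powr p\<close> convex with an increasing derivative, as the increment bounds
    assume.\<close>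
  have p: "1 < p" using a(1) assms(3,4) unfolding a_def by (smt (verit) mult_less_cancel_left2 mult_nonpos_nonneg)
  note K = assms(3,4)
  define P where "P n t = nat \<lfloor>real n * t\<rfloor>" for n :: nat and t :: real
  define X where "X n t \<omega> = real n powr (- (H * K)) * (\<Sum>j = 1..P n t. \<xi> j \<omega>)" for n t \<omega>
  define R where "R s t = 2 powr (-K) * ((s powr p + t powr p) powr K - \<bar>s - t\<bar> powr a)" for s t
  have \<xi>m: "\<xi> j \<in> borel_measurable M" if "1 \<le> j" for j
    using distributed_measurable[OF assms(7)[OF that]] by simp
  have \<xi>cn: "centered_normal M (\<xi> j) 1" if "1 \<le> j" for j
    using M.centered_normal_density[OF _ assms(7)[OF that]] by simp
  have \<xi>int: "integrable M (\<xi> j)" if "1 \<le> j" for j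
    using M.centered_normal_integrable[OF \<xi>cn[OF that]] .
  have \<xi>\<xi>int: "integrable M (\<lambda>\<omega>. \<xi> i \<omega> * \<xi> j \<omega>)" if "1 \<le> i" "1 \<le> j" for i j
    by (intro integrable_mult_of_squares \<xi>m M.centered_normal_square_integrable[OF \<xi>cn] that)
  define c where "c i j = (\<integral>\<omega>. \<xi> (Suc i) \<omega> * \<xi> (Suc j) \<omega> \<partial>M)" for i j
  have Xshift: "X n t = (\<lambda>\<omega>. \<Sum>i<P n t. real n powr (- (H * K)) * \<xi> (Suc i) \<omega>)" for n t
    by (rule ext) (simp add: X_def sum_distrib_left sum.atLeast1_atMost_eq)
  have XXint: "integrable M (\<lambda>\<omega>. X n s \<omega> * X n t \<omega>)" for n s t
    unfolding Xshift sum_product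
    by (intro Bochner_Integration.integrable_sum)
      (simp add: mult.assoc mult.left_commute[of "\<xi> _ _"] \<xi>\<xi>int)
  have cov: "(\<integral>\<omega>. X n s \<omega> * X n t \<omega> \<partial>M) = real n powr (-a) * (\<Sum>i<P n s. \<Sum>j<P n t. c i j)" for n s t
  proof -
    have "(\<integral>\<omega>. X n s \<omega> * X n t \<omega> \<partial>M) =
        (\<integral>\<omega>. (\<Sum>i<P n s. \<Sum>j<P n t. real n powr (-a) * (\<xi> (Suc i) \<omega> * \<xi> (Suc j) \<omega>)) \<partial>M)"
      unfolding Xshift sum_product
      by (intro Bochner_Integration.integral_cong sum.cong refl)
        (simp add: a_def p_def mult_ac flip: powr_add)
    also have "\<dots> = real n powr (-a) * (\<Sum>i<P n s. \<Sum>j<P n t. c i j)"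
      by (simp add: Bochner_Integration.integral_sum \<xi>\<xi>int c_def sum_distrib_left)
    finally show ?thesis .
  qed
  have c_diag: "c i i = 1" for i
    unfolding c_def power2_eq_square[symmetric]
    using M.centered_normal_imp_normal_rv(3)[OF \<xi>cn[of "Suc i"]] by simp
  have c_off: "c i j = 2 powr (-K) * (a * (a - 1) * \<bar>real i - real j\<bar> powr (a - 2)
      - pow_density p K (real (Suc i)) (real (Suc j)))" if "i \<noteq> j" for i j
  proof -
    have e: "2 powr (2 - K) = 4 * 2 powr (-K)" "2 powr (1 - K) = 2 * 2 powr (-K)"
      by (simp_all add: powr_diff powr_minus divide_inverse)
    \<comment> \<open>The factor 4 taken out of \<open>2 powr (2 - K)\<close> turns
      \<open>H\<^sup>2\<close> into \<open>p\<^sup>2\<close>, and the factor 2 taken out of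
      \<open>2 powr (1 - K)\<close> turns \<open>H * K\<close> into \<open>a\<close>;
      \<open>K - 1\<close> supplies the minus sign before the density.\<close>
    have g: "bfbm_g H K x y = 2 powr (-K) * (a * (a - 1) * \<bar>x - y\<bar> powr (a - 2) - pow_density p K x y)" for x y
      unfolding bfbm_g_def pow_density_def e powr_mult unfolding a_def p_def
      by (simp add: power2_eq_square algebra_simps)
    have "c i j = bfbm_g H K (real (Suc i)) (real (Suc j))"
      unfolding c_def using that by (intro assms(8)) auto
    also have "\<dots> = 2 powr (-K) * (a * (a - 1) * \<bar>real (Suc i) - real (Suc j)\<bar> powr (a - 2)
        - pow_density p K (real (Suc i)) (real (Suc j)))"
      by (rule g)
    finally show ?thesis by simp
  qed
  have cov_lim: "(\<lambda>n. \<integral>\<omega>. X n s \<omega> * X n t \<omega> \<partial>M) \<longlonglongrightarrow> R s t" if "0 \<le> s" "0 \<le> t" for s t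
    unfolding cov R_def P_def
    by (rule covariance_sum_tendsto[OF p K a_def a c_diag c_off floor_mult_divide_tendsto[OF that(1)]
          floor_mult_divide_tendsto[OF that(2)] that])
  have Xm: "X n t \<in> borel_measurable M" for n t
    unfolding Xshift by (intro borel_measurable_sum borel_measurable_times borel_measurable_const \<xi>m) simp
  have Xsq: "integrable M (\<lambda>\<omega>. (X n t \<omega>)\<^sup>2)" for n t
    using XXint[of n t t] by (simp add: power2_eq_square)
  have Xcn: "centered_normal M (\<lambda>\<omega>. \<Sum>t\<in>J. u t * X n t \<omega>)
      (\<Sum>s\<in>J. \<Sum>t\<in>J. u s * u t * (\<integral>\<omega>. X n s \<omega> * X n t \<omega> \<partial>M))" if J: "finite J" for J u n
  proof -
    \<comment> \<open>A common upper bound on the numbers of summands, so that a combination of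
      partial sums becomes one combination of the \<open>\<xi> j\<close>.\<close>
    define m where "m = (\<Sum>t\<in>J. P n t)"
    have m: "P n t \<le> m" if "t \<in> J" for t
      unfolding m_def using that J by (intro member_le_sum) auto
    have "(\<Sum>t\<in>J. u t * X n t \<omega>) =
        (\<Sum>j = 1..m. (\<Sum>t\<in>J. if j \<le> P n t then u t * real n powr (- (H * K)) else 0) * \<xi> j \<omega>)" for \<omega>
    proof -
      have "(\<Sum>t\<in>J. u t * X n t \<omega>) =
          (\<Sum>t\<in>J. \<Sum>j = 1..m. (if j \<le> P n t then u t * real n powr (- (H * K)) else 0) * \<xi> j \<omega>)"
      proof (rule sum.cong)
        fix t assume t: "t \<in> J"
        have "{1..m} \<inter> {j. j \<le> P n t} = {1..P n t}" using m[OF t] by auto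
        then show "u t * X n t \<omega> = (\<Sum>j = 1..m. (if j \<le> P n t then u t * real n powr (- (H * K)) else 0) * \<xi> j \<omega>)"
          by (simp add: X_def if_distrib[of "\<lambda>x. x * _"] sum.If_cases sum_distrib_left mult.assoc cong: if_cong)
      qed simp
      then show ?thesis by (subst (asm) sum.swap) (simp add: sum_distrib_right)
    qed
    then have normal: "normal_rv M (\<lambda>\<omega>. \<Sum>t\<in>J. u t * X n t \<omega>)"
      using assms(6) unfolding jointly_gaussian_def by simp
    have "(\<integral>\<omega>. X n t \<omega> \<partial>M) = 0" for t
      unfolding Xshift using M.centered_normal_imp_normal_rv(2)[OF \<xi>cn] \<xi>int
      by (simp add: Bochner_Integration.integral_sum)
    moreover have "integrable M (X n t)" for t
      by (rule M.square_integrable_imp_integrable[OF Xm Xsq])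
    ultimately have "(\<integral>\<omega>. (\<Sum>t\<in>J. u t * X n t \<omega>) \<partial>M) = 0"
      by (simp add: Bochner_Integration.integral_sum)
    from M.normal_rv_imp_centered_normal(2)[OF normal this] show ?thesis
      by (simp add: integral_square_sum XXint)
  qed
  have R_psd: "psd_kernel {0..} R"
    unfolding psd_kernel_def
  proof (intro conjI ballI allI impI)
    show "R s t = R t s" for s t by (simp add: R_def add.commute abs_minus_commute)
    fix n :: nat and t :: "nat \<Rightarrow> real" and c assume t: "\<forall>i<n. t i \<in> {0..}"
    show "0 \<le> (\<Sum>i<n. \<Sum>j<n. c i * c j * R (t i) (t j))"
    proof (rule LIMSEQ_le_const)
      show "(\<lambda>k. \<Sum>i<n. \<Sum>j<n. c i * c j * (\<integral>\<omega>. X k (t i) \<omega> * X k (t j) \<omega> \<partial>M))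
          \<longlonglongrightarrow> (\<Sum>i<n. \<Sum>j<n. c i * c j * R (t i) (t j))"
        using t by (intro tendsto_sum tendsto_mult tendsto_const cov_lim) auto
      \<comment> \<open>Before the limit, the quadratic form is the second moment of a combination
        of partial sums.\<close>
      have "0 \<le> (\<integral>\<omega>. (\<Sum>i<n. c i * X k (t i) \<omega>)\<^sup>2 \<partial>M)" for k by simp
      then show "\<exists>N. \<forall>k\<ge>N. 0 \<le> (\<Sum>i<n. \<Sum>j<n. c i * c j * (\<integral>\<omega>. X k (t i) \<omega> * X k (t j) \<omega> \<partial>M))"
        by (simp add: integral_square_sum XXint)
    qed
  qed
  \<comment> \<open>All fractions of natural numbers, coded by pairs; the floor approximations of a
    time \<open>t\<close> are among them, and \<open>R\<close> is continuous.\<close>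
  define q where "q k = (case prod_decode k of (i, n) \<Rightarrow> real i / real n)" for k
  have R_lim: "(\<lambda>n. R (x n) (y n)) \<longlonglongrightarrow> R s t"
    if "x \<longlonglongrightarrow> s" "y \<longlonglongrightarrow> t" "\<And>n. 0 \<le> x n" "\<And>n. 0 \<le> y n" for x y :: "nat \<Rightarrow> real" and s t
    unfolding R_def using p K a that
    by (intro tendsto_mult tendsto_diff tendsto_add tendsto_powr' tendsto_rabs tendsto_const disjI2 conjI) auto
  have dense: "\<forall>t\<in>{0..}. \<forall>e>0. \<exists>k. R t t - 2 * R t (q k) + R (q k) (q k) < e"
  proof (intro ballI allI impI)
    fix t e :: real assume t: "t \<in> {0..}" and e: "0 < e"
    define x where "x n = real (P n t) / real n" for n
    have x: "x \<longlonglongrightarrow> t" unfolding x_def P_def using t by (intro floor_mult_divide_tendsto) simp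
    have "(\<lambda>n. R t t - 2 * R t (x n) + R (x n) (x n)) \<longlonglongrightarrow> R t t - 2 * R t t + R t t"
      using t by (intro tendsto_intros R_lim x) (auto simp: x_def)
    then have "\<forall>\<^sub>F n in sequentially. R t t - 2 * R t (x n) + R (x n) (x n) < e"
      using e by (intro order_tendstoD(2)) auto
    then obtain n where "R t t - 2 * R t (x n) + R (x n) (x n) < e"
      by (auto simp: eventually_sequentially)
    moreover have "x n = q (prod_encode (P n t, n))" by (simp add: x_def q_def)
    ultimately show "\<exists>k. R t t - 2 * R t (q k) + R (q k) (q k) < e" by auto
  qed
  have q: "q k \<in> {0..}" for k by (simp add: q_def split: prod.split)
  obtain B where B: "\<And>J c. finite J \<Longrightarrow> J \<subseteq> {0..} \<Longrightarrow>
    centered_normal white_noise (\<lambda>\<omega>. \<Sum>t\<in>J. c t * B t \<omega>) (\<Sum>s\<in>J. \<Sum>t\<in>J. c s * c t * R s t)"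
    using gaussian_process_exists[OF R_psd q dense] by blast
  have Bcn: "centered_normal white_noise (B t) (R t t)" if "0 \<le> t" for t
    using B[of "{t}" "\<lambda>_. 1"] that by simp
  have "bifractional_brownian_motion H K white_noise B"
    unfolding bifractional_brownian_motion_def jointly_gaussian_def
  proof (intro conjI allI impI)
    show "normal_rv white_noise (\<lambda>\<omega>. \<Sum>t\<in>J. c t * B t \<omega>)" if "finite J \<and> J \<subseteq> {0..}" for J c
      using W.centered_normal_imp_normal_rv(1)[OF B] that by blast
    show "(\<integral>\<omega>. B t \<omega> \<partial>white_noise) = 0" if "0 \<le> t" for t
      by (rule W.centered_normal_imp_normal_rv(2)[OF Bcn[OF that]])
    show "(\<integral>\<omega>. B t \<omega> * B s \<omega> \<partial>white_noise) =
        2 powr (-K) * ((t powr (2*H) + s powr (2*H)) powr K - \<bar>t - s\<bar> powr (2*H*K))" if "0 \<le> t" "0 \<le> s" for t s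
      using W.centered_normal_covariance[OF B psd_kernel_sym[OF R_psd]] that
      by (simp add: R_def p_def a_def)
  qed (use assms(1-4) prob_space_white_noise in auto)
  moreover have "fdd_converges {0..} M X white_noise B"
    unfolding fdd_converges_def
  proof (intro allI impI, elim conjE)
    fix J :: "real set" assume J: "finite J" "J \<subseteq> {0..}"
    \<comment> \<open>Convergent second moments are bounded in \<open>n\<close>; this gives the
      \<open>V\<close> of the weak convergence criterion.\<close>
    have "(\<lambda>n. \<Sum>t\<in>J. \<integral>\<omega>. (X n t \<omega>)\<^sup>2 \<partial>M) \<longlonglongrightarrow> (\<Sum>t\<in>J. R t t)"
      unfolding power2_eq_square using J by (intro tendsto_sum cov_lim) auto
    then have "Bseq (\<lambda>n. \<Sum>t\<in>J. \<integral>\<omega>. (X n t \<omega>)\<^sup>2 \<partial>M)"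
      by (rule convergent_imp_Bseq[OF convergentI])
    then obtain V0 where V0: "\<And>n. \<bar>\<Sum>t\<in>J. \<integral>\<omega>. (X n t \<omega>)\<^sup>2 \<partial>M\<bar> \<le> V0"
      unfolding Bseq_def by auto
    show "weakly_converges (product_topology (\<lambda>_. euclideanreal) J)
        (\<lambda>n. fd_law M (X n) J) (fd_law white_noise B J)"
    proof (rule fd_law_weakly_converges[OF M.prob_space_axioms prob_space_white_noise J(1) Xm _ Xsq,
          where V="max V0 (\<Sum>t\<in>J. R t t)"])
      show "B t \<in> borel_measurable white_noise" "integrable white_noise (\<lambda>\<omega>. (B t \<omega>)\<^sup>2)" if "t \<in> J" for t
        using Bcn[THEN centered_normal_measurable, of t]
          Bcn[THEN W.centered_normal_square_integrable, of t] that J by auto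
      show "(\<Sum>t\<in>J. \<integral>\<omega>. (X n t \<omega>)\<^sup>2 \<partial>M) \<le> max V0 (\<Sum>t\<in>J. R t t)" for n
        using V0[of n] by linarith
      have "(\<Sum>t\<in>J. \<integral>\<omega>. (B t \<omega>)\<^sup>2 \<partial>white_noise) = (\<Sum>t\<in>J. R t t)"
        using J by (intro sum.cong refl W.centered_normal_imp_normal_rv(3) Bcn) auto
      then show "(\<Sum>t\<in>J. \<integral>\<omega>. (B t \<omega>)\<^sup>2 \<partial>white_noise) \<le> max V0 (\<Sum>t\<in>J. R t t)" by simp
      fix u b
      have "(\<lambda>n. cos b * exp (- (\<Sum>s\<in>J. \<Sum>t\<in>J. u s * u t * (\<integral>\<omega>. X n s \<omega> * X n t \<omega> \<partial>M)) / 2))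
          \<longlonglongrightarrow> cos b * exp (- (\<Sum>s\<in>J. \<Sum>t\<in>J. u s * u t * R s t) / 2)"
        using J by (intro tendsto_mult tendsto_const tendsto_exp tendsto_divide tendsto_minus tendsto_sum cov_lim) auto
      then show "(\<lambda>n. \<integral>\<omega>. cos ((\<Sum>t\<in>J. u t * X n t \<omega>) + b) \<partial>M)
          \<longlonglongrightarrow> (\<integral>\<omega>. cos ((\<Sum>t\<in>J. u t * B t \<omega>) + b) \<partial>white_noise)"
        by (simp only: M.centered_normal_expectation_cos[OF Xcn[OF J(1)]] W.centered_normal_expectation_cos[OF B[OF J]])
    qed
  qed
  ultimately show ?thesis
    unfolding X_def[abs_def] P_def by blast
qed

end
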